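(* Let $\{(D_i',e)\mid i\in I\}$ be a nonempty family of digroups, all with the same fixed bar-unit $e$, such that $D_i'\cap D_t'=\{e\}$ for all distinct $i,t\in I$. Put $D=\bigcup_{i\in I}D_i'$ and $J=\bigcup_{i\in I}J_i$, where $J_i$ is the group part of $(D_i',e)$, and let $CW(D)$ be the set of good center-words over $D$ with the operations $\vdash$ and $\dashv$ defined in the context. Then $(CW(D),\dot{e})$ is a digroup and it is the free product of the family of digroups $\{(D_i',e)\mid i\in I\}$. Moreover, the group part of $(CW(D),\dot{e})$ is $\{[\underline{u}]\mid u \text{ is a reduced word in } J^+\}$, which is isomorphic to the free product of groups $\Pi^{\ast}_{i\in I}J_i$, and the halo part of $(CW(D),\dot{e})$ is $\{u\dot{a}v\in CW(D)\mid \underline{u^{\sharp}a^{\sharp}v^{\sharp}}=e\}$.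
   Context: **Disemigroups and digroups.** A disemigroup is a set $M$ with two associative binary operations $\vdash,\dashv$ such that for all $a,b,c\in M$: $a\dashv(b\vdash c)=a\dashv(b\dashv c)$, $(a\dashv b)\vdash c=(a\vdash b)\vdash c$, $a\vdash(b\dashv c)=(a\vdash b)\dashv c$. A bar-unit is an element $e\in M$ with $e\vdash a=a\dashv e=a$ for every $a\in M$. A digroup $(M,e)$ is a disemigroup $M$ with a fixed bar-unit $e$ such that for every $a\in M$ there is $a^{-1}\in M$ with $a\vdash a^{-1}=e=a^{-1}\dashv a$ (this $a^{-1}$ is unique). The group part of $(M,e)$ is $\{a^{-1}\mid a\in M\}$; it is known that it equals $\{a\vdash e\mid a\in M\}$, that $\vdash$ and $\dashv$ coincide on it, and that it is a group with unit $e$. The halo part of $(M,e)$ is the set of all $d\in M$ with $d\vdash a=a\dashv d=a$ for every $a\in M$. A digroup homomorphism $(M_1,e_1)\to(M_2,e_2)$ is a map preserving $\vdash$ and $\dashv$ and sending $e_1$ to $e_2$. A free product of a family of digroups $\{(M_i,e_i)\mid i\in I\}$ is a digroup $(M,e)$ such that (i) there is an injective digroup homomorphism $\varphi_i:(M_i,e_i)\to(M,e)$ for every $i\in I$; (ii) for every digroup $(G,e')$ and digroup homomorphisms $\psi_i:(M_i,e_i)\to(G,e')$ ($i\in I$), there is a unique digroup homomorphism $\eta:(M,e)\to(G,e')$ with $\eta\varphi_i=\psi_i$ for every $i\in I$. It is unique up to isomorphism. (Any family of digroups can be replaced by isomorphic copies $(D_i',e)$ that share the fixed bar-unit $e$ and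 are otherwise pairwise disjoint.) **Words.** For a set $X$, $X^+$ and $X^*$ denote the free semigroup and free monoid on $X$; $\varepsilon$ is the empty word. Each $a\in D\setminus\{e\}$ lies in a unique $D_i'$; write $\sigma(a)=i$. A good word over $D$ is either $e$, or a word $c_1c_2\cdots c_n$ with $n\ge1$, all $c_t\in D\setminus\{e\}$ and $\sigma(c_p)\ne\sigma(c_{p+1})$ for all $p\le n-1$. $W(D)$ is the set of good words. A reduced word in $J^+$ is an element of $W(D)\cap J^+$. Let $\Pi^{\ast}_{i\in I}J_i$ be the free product of the groups $J_i$, each $J_i$ regarded as a subgroup. For $u\in J^+$, $\underline{u}$ denotes the unique reduced word in $J^+$ representing the same element of $\Pi^{\ast}_{i\in I}J_i$ as $u$. **The map $^\sharp$.** For $a\in D_i'$ put $a^\sharp=a\vdash e\in J_i$ (product in $D_i'$); for $u=a_1\cdots a_m\in D^+$ ($a_t\in D$) put $u^\sharp=a_1^\sharp\cdots a_m^\sharp\in J^+$; and $\varepsilon^\sharp=e$. **Center-words.** Formal expressions $u\dot{a}v$ are words $uav$ with a marked letter $a\in D$, where $u,v\in J^*$ (if $u$ or $v$ is empty it is omitted). The set of good center-words is $$CW(D)=\{u\dot{a}v\mid u,v\in J^*,\ a\in D,\ uav\in W(D);\ \text{if } a\in J\text{ then }u=\varepsilon\}.$$ **Bracket.** For $u=a_1\cdots a_m$, $v=b_1\cdots b_n$, each a reduced word in $J^+$ or empty (all $a_t,b_t\in J$), and $a\in D\setminus J$, define $[u\dot{a}v]\in CW(D)$ as follows. Let $i=\sigma(a)$.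 - If $a_m\notin D_i'$ and $b_1\notin D_i'$: $[u\dot av]=u\dot av$. - If $a_m\in D_i'$, $b_1\notin D_i'$: $[u\dot av]=a_1\cdots a_{m-1}\dot{c}v$ with $c=a_m\vdash a\in D_i'$. - If $a_m\notin D_i'$, $b_1\in D_i'$: $[u\dot av]=u\dot{c}b_2\cdots b_n$ with $c=a\dashv b_1\in D_i'$. - If $a_m,b_1\in D_i'$: $[u\dot av]=a_1\cdots a_{m-1}\dot{c}b_2\cdots b_n$ with $c=(a_m\vdash a)\dashv b_1\in D_i'$. (If $u$ or $v$ is empty, the corresponding letter $a_m$ or $b_1$ is absent and is treated as not lying in $D_i'$.) For a reduced word $u=a_1\cdots a_m\in J^+$, put $[u]=\dot{a}_1a_2\cdots a_m$. **Operations on $CW(D)$.** For $u_1\dot a_1v_1,u_2\dot a_2v_2\in CW(D)$: $$u_1\dot a_1v_1\vdash u_2\dot a_2v_2=\begin{cases}[\underline{u_1^\sharp a_1^\sharp v_1^\sharp u_2^\sharp}\,\dot a_2v_2^\sharp],& a_2\in D\setminus J,\\ [\underline{u_1^\sharp a_1^\sharp v_1^\sharp u_2^\sharp a_2^\sharp v_2^\sharp}],& a_2\in J,\end{cases}$$ $$u_1\dot a_1v_1\dashv u_2\dot a_2v_2=\begin{cases}[u_1^\sharp\dot a_1\,\underline{v_1^\sharp u_2^\sharp a_2^\sharp v_2^\sharp}],& a_1\in D\setminus J,\\ [\underline{u_1^\sharp a_1^\sharp v_1^\sharp u_2^\sharp a_2^\sharp v_2^\sharp}],& a_1\in J.\end{cases}$$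 *)

theory Defs
  imports "HOL-Algebra.Coset" "HOL-Library.FuncSet"
begin

section \<open>Digroups\<close>

record 'a digroup = "'a partial_object" +
  ldot :: "['a, 'a] \<Rightarrow> 'a" (infixl \<open>\<turnstile>\<index>\<close> 70)
  rdot :: "['a, 'a] \<Rightarrow> 'a" (infixl \<open>\<stileturn>\<index>\<close> 70)
  bar_unit :: 'a

locale disemigroup =
  fixes M (structure)
  assumes ldot_closed: "\<lbrakk>a \<in> carrier M; b \<in> carrier M\<rbrakk> \<Longrightarrow> a \<turnstile> b \<in> carrier M"
    and rdot_closed: "\<lbrakk>a \<in> carrier M; b \<in> carrier M\<rbrakk> \<Longrightarrow> a \<stileturn> b \<in> carrier M"
    and ldot_assoc: "\<lbrakk>a \<in> carrier M; b \<in> carrier M; c \<in> carrier M\<rbrakk>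
      \<Longrightarrow> (a \<turnstile> b) \<turnstile> c = a \<turnstile> (b \<turnstile> c)"
    and rdot_assoc: "\<lbrakk>a \<in> carrier M; b \<in> carrier M; c \<in> carrier M\<rbrakk>
      \<Longrightarrow> (a \<stileturn> b) \<stileturn> c = a \<stileturn> (b \<stileturn> c)"
    and rdot_ldot: "\<lbrakk>a \<in> carrier M; b \<in> carrier M; c \<in> carrier M\<rbrakk>
      \<Longrightarrow> a \<stileturn> (b \<turnstile> c) = a \<stileturn> (b \<stileturn> c)"
    and ldot_rdot: "\<lbrakk>a \<in> carrier M; b \<in> carrier M; c \<in> carrier M\<rbrakk>
      \<Longrightarrow> (a \<stileturn> b) \<turnstile> c = (a \<turnstile> b) \<turnstile> c"
    and inner_assoc: "\<lbrakk>a \<in> carrier M; b \<in> carrier M; c \<in> carrier M\<rbrakk>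
      \<Longrightarrow> a \<turnstile> (b \<stileturn> c) = (a \<turnstile> b) \<stileturn> c"

definition halo_part :: "('a, 'm) digroup_scheme \<Rightarrow> 'a set"
  where "halo_part M =
    {d \<in> carrier M. \<forall>a\<in>carrier M. d \<turnstile>\<^bsub>M\<^esub> a = a \<and> a \<stileturn>\<^bsub>M\<^esub> d = a}"

definition is_diinverse :: "('a, 'm) digroup_scheme \<Rightarrow> 'a \<Rightarrow> 'a \<Rightarrow> bool"
  where "is_diinverse M a b \<longleftrightarrow>
    b \<in> carrier M \<and> a \<turnstile>\<^bsub>M\<^esub> b = bar_unit M \<and> b \<stileturn>\<^bsub>M\<^esub> a = bar_unit M"

text \<open>The elements of the halo part are exactly the bar-units.\<close>

locale digroup = disemigroup +
  assumes bar_unit: "bar_unit M \<in> halo_part M"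
    and ex_diinverse: "a \<in> carrier M \<Longrightarrow> \<exists>b. is_diinverse M a b"

definition diinverse :: "('a, 'm) digroup_scheme \<Rightarrow> 'a \<Rightarrow> 'a"
  where "diinverse M a = (THE b. is_diinverse M a b)"

definition group_part :: "('a, 'm) digroup_scheme \<Rightarrow> 'a set"
  where "group_part M = diinverse M ` carrier M"

text \<open>The two products of a digroup agree on its group part, so either one may be used
  for the group structure.\<close>

definition group_part_group :: "('a, 'm) digroup_scheme \<Rightarrow> 'a monoid"
  where "group_part_group M =
    \<lparr>carrier = group_part M, mult = (\<turnstile>\<^bsub>M\<^esub>), one = bar_unit M\<rparr>"

definition dihom :: "('a, 'm) digroup_scheme \<Rightarrow> ('b, 'n) digroup_scheme \<Rightarrow> ('a \<Rightarrow> 'b) set"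
  where "dihom M N =
    {h \<in> carrier M \<rightarrow> carrier N.
      (\<forall>a\<in>carrier M. \<forall>b\<in>carrier M. h (a \<turnstile>\<^bsub>M\<^esub> b) = h a \<turnstile>\<^bsub>N\<^esub> h b) \<and>
      (\<forall>a\<in>carrier M. \<forall>b\<in>carrier M. h (a \<stileturn>\<^bsub>M\<^esub> b) = h a \<stileturn>\<^bsub>N\<^esub> h b) \<and>
      h (bar_unit M) = bar_unit N}"

text \<open>HOL cannot quantify over all types inside a formula, so the type of the elements of the
  test digroups \<open>G\<close> is a parameter. The embeddings \<open>\<phi>\<close> are an argument rather than
  existentially quantified, so that they cannot depend on that type.
  Maps out of \<open>M\<close> are made unique by requiring them to be extensional.\<close>

definition digroup_free_product ::
    "'b itself \<Rightarrow> 'i set \<Rightarrow> ('i \<Rightarrow> 'a digroup) \<Rightarrow> 'c digroup \<Rightarrow> ('i \<Rightarrow> 'a \<Rightarrow> 'c) \<Rightarrow> bool"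
  where "digroup_free_product (T :: 'b itself) I D M \<phi> \<longleftrightarrow>
    digroup M \<and>
    (\<forall>i\<in>I. \<phi> i \<in> dihom (D i) M \<and> inj_on (\<phi> i) (carrier (D i))) \<and>
    (\<forall>(G :: 'b digroup) \<psi>.
      digroup G \<and> (\<forall>i\<in>I. \<psi> i \<in> dihom (D i) G) \<longrightarrow>
      (\<exists>!\<eta>. \<eta> \<in> dihom M G \<inter> extensional (carrier M) \<and>
        (\<forall>i\<in>I. \<forall>a\<in>carrier (D i). \<eta> (\<phi> i a) = \<psi> i a)))"


section \<open>Free products of groups\<close>

text \<open>The free product of a family of groups consists of the words in the disjoint union of the
  groups, modulo the congruence that multiplies adjacent letters from the same group and
  deletes letters that are units.\<close>

definition free_product_words :: "'i set \<Rightarrow> ('i \<Rightarrow> ('a, 'm) monoid_scheme) \<Rightarrow> ('i \<times> 'a) list set"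
  where "free_product_words I G = lists (SIGMA i:I. carrier (G i))"

inductive_set free_product_rel ::
    "'i set \<Rightarrow> ('i \<Rightarrow> ('a, 'm) monoid_scheme) \<Rightarrow> (('i \<times> 'a) list \<times> ('i \<times> 'a) list) set"
  for I :: "'i set" and G :: "'i \<Rightarrow> ('a, 'm) monoid_scheme" where
  refl: "w \<in> free_product_words I G \<Longrightarrow> (w, w) \<in> free_product_rel I G"
| sym: "(v, w) \<in> free_product_rel I G \<Longrightarrow> (w, v) \<in> free_product_rel I G"
| trans: "\<lbrakk>(u, v) \<in> free_product_rel I G; (v, w) \<in> free_product_rel I G\<rbrakk>
    \<Longrightarrow> (u, w) \<in> free_product_rel I G"
| mult: "\<lbrakk>p \<in> free_product_words I G; q \<in> free_product_words I G; i \<in> I;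
      a \<in> carrier (G i); b \<in> carrier (G i)\<rbrakk>
    \<Longrightarrow> (p @ [(i, a), (i, b)] @ q, p @ [(i, a \<otimes>\<^bsub>G i\<^esub> b)] @ q) \<in> free_product_rel I G"
| one: "\<lbrakk>p \<in> free_product_words I G; q \<in> free_product_words I G; i \<in> I\<rbrakk>
    \<Longrightarrow> (p @ [(i, \<one>\<^bsub>G i\<^esub>)] @ q, p @ q) \<in> free_product_rel I G"

definition free_product_class ::
    "'i set \<Rightarrow> ('i \<Rightarrow> ('a, 'm) monoid_scheme) \<Rightarrow> ('i \<times> 'a) list \<Rightarrow> ('i \<times> 'a) list set"
  where "free_product_class I G w = free_product_rel I G `` {w}"

definition free_product_group ::
    "'i set \<Rightarrow> ('i \<Rightarrow> ('a, 'm) monoid_scheme) \<Rightarrow> ('i \<times> 'a) list set monoid"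
  where "free_product_group I G =
    \<lparr>carrier = free_product_words I G // free_product_rel I G,
     mult = (\<lambda>A B. \<Union>v\<in>A. \<Union>w\<in>B. free_product_class I G (v @ w)),
     one = free_product_class I G []\<rparr>"


section \<open>Words over a family of digroups\<close>

text \<open>Throughout, \<open>D\<close> is a family of digroups indexed by \<open>I\<close> that share the bar-unit \<open>e\<close>
  and are otherwise pairwise disjoint.\<close>

definition letters :: "'i set \<Rightarrow> ('i \<Rightarrow> 'a digroup) \<Rightarrow> 'a set"
  where "letters I D = (\<Union>i\<in>I. carrier (D i))"

definition group_letters :: "'i set \<Rightarrow> ('i \<Rightarrow> 'a digroup) \<Rightarrow> 'a set"
  where "group_letters I D = (\<Union>i\<in>I. group_part (D i))"

text \<open>The index of a letter other than \<open>e\<close> is unique. For \<open>e\<close> an arbitrary index is chosen;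
  nothing below depends on that choice.\<close>

definition index_of :: "'i set \<Rightarrow> ('i \<Rightarrow> 'a digroup) \<Rightarrow> 'a \<Rightarrow> 'i"
  where "index_of I D a = (SOME i. i \<in> I \<and> a \<in> carrier (D i))"

definition good_words :: "'i set \<Rightarrow> ('i \<Rightarrow> 'a digroup) \<Rightarrow> 'a \<Rightarrow> 'a list set"
  where "good_words I D e = {[e]} \<union>
    {c. c \<noteq> [] \<and> c \<in> lists (letters I D - {e}) \<and>
      successively (\<lambda>a b. index_of I D a \<noteq> index_of I D b) c}"

definition reduced_words :: "'i set \<Rightarrow> ('i \<Rightarrow> 'a digroup) \<Rightarrow> 'a \<Rightarrow> 'a list set"
  where "reduced_words I D e = {w \<in> good_words I D e. w \<noteq> [] \<and> w \<in> lists (group_letters I D)}"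

definition group_parts :: "('i \<Rightarrow> 'a digroup) \<Rightarrow> 'i \<Rightarrow> 'a monoid"
  where "group_parts D i = group_part_group (D i)"

text \<open>The element of the free product of the group parts represented by a word in their union.\<close>

definition represented :: "'i set \<Rightarrow> ('i \<Rightarrow> 'a digroup) \<Rightarrow> 'a list \<Rightarrow> ('i \<times> 'a) list set"
  where "represented I D u =
    free_product_class I (group_parts D) (map (\<lambda>a. (index_of I D a, a)) u)"

definition reduce :: "'i set \<Rightarrow> ('i \<Rightarrow> 'a digroup) \<Rightarrow> 'a \<Rightarrow> 'a list \<Rightarrow> 'a list"
  where "reduce I D e u =
    (THE w. w \<in> reduced_words I D e \<and> represented I D w = represented I D u)"

definition sharp :: "'i set \<Rightarrow> ('i \<Rightarrow> 'a digroup) \<Rightarrow> 'a \<Rightarrow> 'a \<Rightarrow> 'a"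
  where "sharp I D e a = a \<turnstile>\<^bsub>D (index_of I D a)\<^esub> e"

definition sharp_word :: "'i set \<Rightarrow> ('i \<Rightarrow> 'a digroup) \<Rightarrow> 'a \<Rightarrow> 'a list \<Rightarrow> 'a list"
  where "sharp_word I D e u = (if u = [] then [e] else map (sharp I D e) u)"


section \<open>The digroup of good center-words\<close>

text \<open>The center-word \<open>u\<close>, marked letter \<open>a\<close>, \<open>v\<close> is encoded as the triple \<open>(u, a, v)\<close>.\<close>

type_synonym 'a center_word = "'a list \<times> 'a \<times> 'a list"

definition center_letter :: "'a \<Rightarrow> 'a center_word"
  where "center_letter a = ([], a, [])"

definition center_words :: "'i set \<Rightarrow> ('i \<Rightarrow> 'a digroup) \<Rightarrow> 'a \<Rightarrow> 'a center_word set"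
  where "center_words I D e =
    {(u, a, v). u \<in> lists (group_letters I D) \<and> v \<in> lists (group_letters I D) \<and>
      a \<in> letters I D \<and> u @ [a] @ v \<in> good_words I D e \<and>
      (a \<in> group_letters I D \<longrightarrow> u = [])}"

definition bracket :: "'i set \<Rightarrow> ('i \<Rightarrow> 'a digroup) \<Rightarrow> 'a list \<Rightarrow> 'a \<Rightarrow> 'a list \<Rightarrow> 'a center_word"
  where "bracket I D u a v =
    (let M = D (index_of I D a);
         l = (u \<noteq> [] \<and> last u \<in> carrier M);
         r = (v \<noteq> [] \<and> hd v \<in> carrier M)
     in if \<not> l \<and> \<not> r then (u, a, v)
        else if l \<and> \<not> r then (butlast u, last u \<turnstile>\<^bsub>M\<^esub> a, v)
        else if \<not> l \<and> r then (u, a \<stileturn>\<^bsub>M\<^esub> hd v, tl v)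
        else (butlast u, (last u \<turnstile>\<^bsub>M\<^esub> a) \<stileturn>\<^bsub>M\<^esub> hd v, tl v))"

definition group_bracket :: "'a list \<Rightarrow> 'a center_word"
  where "group_bracket u = ([], hd u, tl u)"

definition cw_ldot ::
    "'i set \<Rightarrow> ('i \<Rightarrow> 'a digroup) \<Rightarrow> 'a \<Rightarrow> 'a center_word \<Rightarrow> 'a center_word \<Rightarrow> 'a center_word"
  where "cw_ldot I D e = (\<lambda>(u1, a1, v1) (u2, a2, v2).
    let s = sharp_word I D e in
    if a2 \<notin> group_letters I D
    then bracket I D (reduce I D e (s u1 @ s [a1] @ s v1 @ s u2)) a2 (s v2)
    else group_bracket (reduce I D e (s u1 @ s [a1] @ s v1 @ s u2 @ s [a2] @ s v2)))"

definition cw_rdot ::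
    "'i set \<Rightarrow> ('i \<Rightarrow> 'a digroup) \<Rightarrow> 'a \<Rightarrow> 'a center_word \<Rightarrow> 'a center_word \<Rightarrow> 'a center_word"
  where "cw_rdot I D e = (\<lambda>(u1, a1, v1) (u2, a2, v2).
    let s = sharp_word I D e in
    if a1 \<notin> group_letters I D
    then bracket I D (s u1) a1 (reduce I D e (s v1 @ s u2 @ s [a2] @ s v2))
    else group_bracket (reduce I D e (s u1 @ s [a1] @ s v1 @ s u2 @ s [a2] @ s v2)))"

definition cw_digroup :: "'i set \<Rightarrow> ('i \<Rightarrow> 'a digroup) \<Rightarrow> 'a \<Rightarrow> 'a center_word digroup"
  where "cw_digroup I D e =
    \<lparr>carrier = center_words I D e, ldot = cw_ldot I D e, rdot = cw_rdot I D e,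
     bar_unit = center_letter e\<rparr>"

end

theory Submission
  imports Defs
begin

text \<open>By van der Waerden's argument the letters in \<open>J\<close> act on reduced words, which gives a normal
  form for the free product of the group parts. Let \<open>[u a v]\<close>, or \<open>cw u a v\<close>, denote the good center-word
  obtained by reducing \<open>u\<close> and \<open>v\<close> and absorbing their letters next to \<open>a\<close>, for arbitrary words
  \<open>u\<close>, \<open>v\<close> over \<open>J\<close>. The key point is that the two operations become concatenation:
  \<open>[u a v] \<turnstile> [u' a' v'] = [(u a\<^sup>\<sharp> v u') a' v']\<close> and \<open>[u a v] \<stileturn> [u' a' v'] = [u a (v u' a'\<^sup>\<sharp> v')]\<close>, also
  when \<open>u\<close> and \<open>v\<close> are not reduced. So the digroup laws are associativity of concatenation, and
  the map \<open>[u a v] \<mapsto> (\<psi> u \<turnstile> \<psi> a) \<stileturn> \<psi> v\<close> is well defined and a homomorphism.\<close>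


section \<open>The group part of a digroup\<close>

text \<open>Two features of the data obstruct direct computation. The unit \<open>e\<close> lies in
  every \<open>D i\<close>, so it has no index of its own, and as a reduced word it is spelled
  \<open>[e]\<close>; and the bracket has four cases, according to which neighbours it absorbs. Both
  difficulties go away once a missing neighbour is read as the letter \<open>e\<close>. Normal forms
  keep the unit as the empty word, each splits into a possibly trivial letter of a chosen
  \<open>D i\<close> next to a word that does not begin (or end) in \<open>D i\<close>, and the
  bracket becomes the single formula \<open>(l \<turnstile> a) \<stileturn> r\<close>. The
  concatenation rules rest on two invariants: letters of the group part of \<open>D i\<close> may
  pass between the outer words and a center in \<open>D i\<close>, and the group element of
  \<open>u a\<^sup>\<sharp> v\<close> survives bracketing. A left argument of \<turnstile> and a
  right argument of \<stileturn> enter only through that group element. So an inverse of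
  \<open>[u a v]\<close> may be sought with center \<open>e\<close>, and the bar-units are the
  center-words for which that element is trivial.\<close>

context digroup
begin

lemma unit_closed [simp]: "bar_unit M \<in> carrier M"
  using bar_unit by (simp add: halo_part_def)

lemma unit_ldot [simp]: "a \<in> carrier M \<Longrightarrow> bar_unit M \<turnstile> a = a"
  using bar_unit by (simp add: halo_part_def)

lemma rdot_unit [simp]: "a \<in> carrier M \<Longrightarrow> a \<stileturn> bar_unit M = a"
  using bar_unit by (simp add: halo_part_def)

text \<open>Inside a right factor of \<stileturn> the two products are interchangeable, so \<open>b
  = b \<stileturn> (a \<turnstile> b') = (b \<stileturn> a) \<stileturn> b'\<close>. The case of two
  equal inverses gives \<open>bar_unit M \<stileturn> b' = b'\<close>; comparing the two equations
  gives uniqueness.\<close>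

lemma diinverse_unit_rdot:
  assumes "is_diinverse M a b" "is_diinverse M a b'" "a \<in> carrier M"
  shows "bar_unit M \<stileturn> b' = b"
proof -
  have b: "b \<in> carrier M" "b' \<in> carrier M" and ab: "a \<turnstile> b' = bar_unit M" "b \<stileturn> a = bar_unit M"
    using assms by (auto simp: is_diinverse_def)
  have "b = b \<stileturn> (a \<turnstile> b')"
    using b ab by simp
  also have "\<dots> = (b \<stileturn> a) \<stileturn> b'"
    using b assms(3) by (simp add: rdot_ldot rdot_assoc)
  finally show ?thesis
    using ab by simp
qed

lemma diinverse_eq:
  assumes "is_diinverse M a b" "a \<in> carrier M"
  shows "diinverse M a = b"
  unfolding diinverse_def
  using assms diinverse_unit_rdot by (intro the_equality) metis+

lemma is_diinverse_diinverse: "a \<in> carrier M \<Longrightarrow> is_diinverse M a (diinverse M a)"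
  using ex_diinverse diinverse_eq by metis

text \<open>The inverse property only speaks of \<open>b \<stileturn> a\<close>, but the product in
  a left factor of \<turnstile> may be of either kind, so left multiplication by \<open>b\<close>
  still undoes left multiplication by \<open>a\<close>.\<close>

lemma diinverse_ldot_ldot:
  assumes "is_diinverse M a b" "a \<in> carrier M" "c \<in> carrier M"
  shows "b \<turnstile> (a \<turnstile> c) = c"
proof -
  have "b \<in> carrier M"
    using assms by (simp add: is_diinverse_def)
  then have "b \<turnstile> (a \<turnstile> c) = (b \<stileturn> a) \<turnstile> c"
    using assms(2,3) by (simp add: ldot_rdot ldot_assoc)
  then show ?thesis
    using assms by (simp add: is_diinverse_def)
qed

text \<open>An inverse \<open>x\<close> of \<open>a\<close> satisfies \<open>x = x \<turnstile> (a
  \<turnstile> x) = x \<turnstile> bar_unit M\<close>. Conversely, a solution of this equation is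
  the inverse of its own inverse. Closure under products and homomorphisms is easy to check in this
  equational form.\<close>

lemma group_part_iff: "x \<in> group_part M \<longleftrightarrow> x \<in> carrier M \<and> x \<turnstile> bar_unit M = x"
proof
  assume "x \<in> group_part M"
  then obtain a where a: "a \<in> carrier M" "is_diinverse M a x"
    using is_diinverse_diinverse by (auto simp: group_part_def)
  with diinverse_ldot_ldot[OF a(2,1), of x]
  show "x \<in> carrier M \<and> x \<turnstile> bar_unit M = x"
    by (simp add: is_diinverse_def)
next
  assume x: "x \<in> carrier M \<and> x \<turnstile> bar_unit M = x"
  define b where "b = diinverse M x"
  have b: "is_diinverse M x b" "b \<in> carrier M"
    using is_diinverse_diinverse x by (auto simp: b_def is_diinverse_def)
  have "bar_unit M \<stileturn> b = b"
    using diinverse_unit_rdot b x by blast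
  \<comment> \<open>Reassociate \<open>x \<turnstile> (bar_unit M \<stileturn> b)\<close>: the right
    factor is \<open>b\<close>, and \<open>x \<turnstile> bar_unit M\<close> is
    \<open>x\<close>.\<close>
  then have "x \<stileturn> b = x \<turnstile> b"
    using x b inner_assoc[of x "bar_unit M" b] by simp
  moreover have "b \<turnstile> x = bar_unit M"
    using diinverse_ldot_ldot[OF b(1), of "bar_unit M"] x by simp
  ultimately have "is_diinverse M b x"
    using x b by (simp add: is_diinverse_def)
  then show "x \<in> group_part M"
    using diinverse_eq b(2) unfolding group_part_def by blast
qed

lemma group_part_carrier [simp]: "x \<in> group_part M \<Longrightarrow> x \<in> carrier M"
  by (simp add: group_part_iff)

lemma group_part_ldot_unit [simp]: "x \<in> group_part M \<Longrightarrow> x \<turnstile> bar_unit M = x"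
  by (simp add: group_part_iff)

lemma ldot_unit_group_part [simp]: "a \<in> carrier M \<Longrightarrow> a \<turnstile> bar_unit M \<in> group_part M"
  by (simp add: group_part_iff ldot_closed ldot_assoc del: group_part_ldot_unit)

lemma unit_group_part [simp]: "bar_unit M \<in> group_part M"
  by (simp add: group_part_iff)

lemma group_part_unit_rdot [simp]: "x \<in> group_part M \<Longrightarrow> bar_unit M \<stileturn> x = x"
  using is_diinverse_diinverse diinverse_unit_rdot by (auto simp: group_part_def)

lemma group_part_ldot_closed:
  "\<lbrakk>x \<in> group_part M; y \<in> group_part M\<rbrakk> \<Longrightarrow> x \<turnstile> y \<in> group_part M"
  by (simp add: group_part_iff ldot_closed ldot_assoc del: group_part_ldot_unit)

lemma group_part_rdot_eq_ldot:
  "\<lbrakk>x \<in> group_part M; y \<in> group_part M\<rbrakk> \<Longrightarrow> x \<stileturn> y = x \<turnstile> y"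
  using inner_assoc[of x "bar_unit M" y] by simp

lemma ldot_rdot_eq_ldot_ldot:
  "\<lbrakk>x \<in> group_part M; y \<in> group_part M; z \<in> group_part M\<rbrakk> \<Longrightarrow> (x \<turnstile> y) \<stileturn> z = x \<turnstile> (y \<turnstile> z)"
  by (simp add: group_part_rdot_eq_ldot group_part_ldot_closed ldot_assoc)

lemma group_part_inverse:
  assumes "x \<in> group_part M"
  obtains y where "y \<in> group_part M" "x \<turnstile> y = bar_unit M" "y \<turnstile> x = bar_unit M"
proof
  have x: "is_diinverse M x (diinverse M x)"
    using assms by (simp add: is_diinverse_diinverse)
  then show "x \<turnstile> diinverse M x = bar_unit M"
    by (simp add: is_diinverse_def)
  show "diinverse M x \<in> group_part M"
    using assms by (simp add: group_part_def)
  then show "diinverse M x \<turnstile> x = bar_unit M"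
    using x assms by (simp add: is_diinverse_def flip: group_part_rdot_eq_ldot)
qed

text \<open>Multiplying by the inverse of \<open>b\<close> undoes the product. Together with the
  counterpart for \<stileturn> this ensures that absorbing group letters never moves a center letter
  into or out of \<open>J\<close>, the condition on which the operations branch.\<close>

lemma ldot_group_part_iff:
  assumes "b \<in> group_part M" "a \<in> carrier M"
  shows "b \<turnstile> a \<in> group_part M \<longleftrightarrow> a \<in> group_part M"
proof
  assume ba: "b \<turnstile> a \<in> group_part M"
  obtain y where y: "y \<in> group_part M" "y \<turnstile> b = bar_unit M"
    using group_part_inverse assms by metis
  have "a = (y \<turnstile> b) \<turnstile> a"
    using y assms by simp
  also have "\<dots> = y \<turnstile> (b \<turnstile> a)"
    using y(1) assms by (simp add: ldot_assoc)
  also have "\<dots> \<in> group_part M"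
    using group_part_ldot_closed[OF y(1) ba] .
  finally show "a \<in> group_part M" .
qed (simp add: assms group_part_ldot_closed)

lemma rdot_group_part_iff:
  assumes "b \<in> group_part M" "a \<in> carrier M"
  shows "a \<stileturn> b \<in> group_part M \<longleftrightarrow> a \<in> group_part M"
proof
  assume ab: "a \<stileturn> b \<in> group_part M"
  obtain y where y: "y \<in> group_part M" "b \<turnstile> y = bar_unit M"
    using group_part_inverse assms by metis
  have "a = a \<stileturn> (b \<turnstile> y)"
    using y assms by simp
  also have "\<dots> = (a \<stileturn> b) \<turnstile> y"
    using y(1) assms group_part_rdot_eq_ldot[OF ab y(1)] by (simp add: rdot_ldot rdot_assoc)
  also have "\<dots> \<in> group_part M"
    using group_part_ldot_closed[OF ab y(1)] .
  finally show "a \<in> group_part M" .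
qed (simp add: assms group_part_ldot_closed group_part_rdot_eq_ldot)

end

lemma dihom_group_part:
  assumes "digroup M" "digroup N" "h \<in> dihom M N" "x \<in> group_part M"
  shows "h x \<in> group_part N"
proof -
  interpret M: digroup M by fact
  interpret N: digroup N by fact
  have "h x \<turnstile>\<^bsub>N\<^esub> bar_unit N = h (x \<turnstile>\<^bsub>M\<^esub> bar_unit M)"
    using assms(3,4) M.group_part_carrier by (simp add: dihom_def del: M.group_part_ldot_unit)
  then show ?thesis
    using assms(3,4) by (auto simp: N.group_part_iff dihom_def simp del: N.group_part_ldot_unit)
qed


section \<open>Words and classes in a free product of groups\<close>

lemma free_product_words_append [simp]:
  "v @ w \<in> free_product_words I G \<longleftrightarrow> v \<in> free_product_words I G \<and> w \<in> free_product_words I G"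
  by (auto simp: free_product_words_def)

lemma free_product_words_Cons [simp]:
  "x # w \<in> free_product_words I G \<longleftrightarrow>
    fst x \<in> I \<and> snd x \<in> carrier (G (fst x)) \<and> w \<in> free_product_words I G"
  by (cases x) (auto simp: free_product_words_def)

lemma free_product_words_Nil [simp]: "[] \<in> free_product_words I G"
  by (simp add: free_product_words_def)

lemma free_product_rel_words:
  assumes "\<forall>i\<in>I. monoid (G i)"
  shows "(v, w) \<in> free_product_rel I G \<Longrightarrow> v \<in> free_product_words I G \<and> w \<in> free_product_words I G"
  by (induction rule: free_product_rel.induct) (simp_all add: assms monoid.m_closed monoid.one_closed)

lemma free_product_rel_append:
  assumes "(v, w) \<in> free_product_rel I G" "p \<in> free_product_words I G" "q \<in> free_product_words I G"
  shows "(p @ v @ q, p @ w @ q) \<in> free_product_rel I G"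
  using assms
proof (induction rule: free_product_rel.induct)
  case (mult p' q' i a b)
  then show ?case
    using free_product_rel.mult[of "p @ p'" I G "q' @ q" i a b] by simp
next
  case (one p' q' i)
  then show ?case
    using free_product_rel.one[of "p @ p'" I G "q' @ q" i] by simp
next
  case (refl w)
  then show ?case
    by (simp add: free_product_rel.refl)
next
  case (sym v w)
  show ?case
    using free_product_rel.sym[OF sym.IH] sym.prems by simp
next
  case (trans u v w)
  show ?case
    using free_product_rel.trans[OF trans.IH(1,2)] trans.prems by simp
qed

lemma equiv_free_product_rel:
  assumes "\<forall>i\<in>I. monoid (G i)"
  shows "equiv (free_product_words I G) (free_product_rel I G)"
proof (rule equivI)
  show "free_product_rel I G \<subseteq> free_product_words I G \<times> free_product_words I G"
    using free_product_rel_words[OF assms] by auto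
  show "refl_on (free_product_words I G) (free_product_rel I G)"
    by (rule refl_onI) (rule free_product_rel.refl)
  show "sym (free_product_rel I G)"
    by (rule symI) (rule free_product_rel.sym)
  show "trans (free_product_rel I G)"
    by (rule transI) (rule free_product_rel.trans)
qed

text \<open>The product is a union over all pairs of representatives; since the relation is a
  congruence, all of them contribute the same class.\<close>

lemma free_product_class_mult:
  assumes monoids: "\<forall>i\<in>I. monoid (G i)"
    and v: "v \<in> free_product_words I G" and w: "w \<in> free_product_words I G"
  shows "free_product_class I G v \<otimes>\<^bsub>free_product_group I G\<^esub> free_product_class I G w
    = free_product_class I G (v @ w)"
proof -
  note equiv = equiv_free_product_rel[OF monoids]
  have eq: "free_product_class I G (v' @ w') = free_product_class I G (v @ w)"
    if "v' \<in> free_product_class I G v" "w' \<in> free_product_class I G w" for v' w'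
  proof -
    have vw': "(v, v') \<in> free_product_rel I G" "(w, w') \<in> free_product_rel I G"
      using that by (auto simp: free_product_class_def)
    then have "v' \<in> free_product_words I G" "w' \<in> free_product_words I G"
      using free_product_rel_words[OF monoids] by blast+
    then have "(v @ w, v' @ w) \<in> free_product_rel I G" "(v' @ w, v' @ w') \<in> free_product_rel I G"
      using free_product_rel_append[OF vw'(1), of "[]" w] free_product_rel_append[OF vw'(2), of v' "[]"] w
      by simp_all
    then have "(v @ w, v' @ w') \<in> free_product_rel I G"
      by (rule free_product_rel.trans)
    from equiv_class_eq[OF equiv this] show ?thesis
      by (simp add: free_product_class_def)
  qed
  have "v \<in> free_product_class I G v" "w \<in> free_product_class I G w"
    using v w by (auto simp: free_product_class_def intro: free_product_rel.refl)
  then have "(\<Union>v'\<in>free_product_class I G v. \<Union>w'\<in>free_product_class I G w.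
      free_product_class I G (v' @ w')) = free_product_class I G (v @ w)"
    using eq by blast
  then show ?thesis
    by (simp add: free_product_group_def)
qed


section \<open>Normal forms in the free product of the group parts\<close>

locale digroup_family =
  fixes I :: "'i set" and D :: "'i \<Rightarrow> 'a digroup" and e :: 'a
  assumes nonempty: "I \<noteq> {}"
    and digroups: "\<And>i. i \<in> I \<Longrightarrow> digroup (D i)"
    and common_unit: "\<And>i. i \<in> I \<Longrightarrow> bar_unit (D i) = e"
    and disjoint: "\<And>i t. \<lbrakk>i \<in> I; t \<in> I; i \<noteq> t\<rbrakk> \<Longrightarrow> carrier (D i) \<inter> carrier (D t) = {e}"
begin

abbreviation L where "L \<equiv> letters I D"
abbreviation J where "J \<equiv> group_letters I D"
abbreviation idx where "idx \<equiv> index_of I D"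

lemma unit_closed [simp]: "i \<in> I \<Longrightarrow> e \<in> carrier (D i)"
  using digroup.unit_closed digroups common_unit by metis

lemma unit_group_part [simp]: "i \<in> I \<Longrightarrow> e \<in> group_part (D i)"
  using digroup.unit_group_part digroups common_unit by metis

lemma unit_ldot [simp]: "\<lbrakk>i \<in> I; a \<in> carrier (D i)\<rbrakk> \<Longrightarrow> e \<turnstile>\<^bsub>D i\<^esub> a = a"
  using digroup.unit_ldot digroups common_unit by metis

lemma rdot_unit [simp]: "\<lbrakk>i \<in> I; a \<in> carrier (D i)\<rbrakk> \<Longrightarrow> a \<stileturn>\<^bsub>D i\<^esub> e = a"
  using digroup.rdot_unit digroups common_unit by metis

lemma group_part_ldot_unit [simp]: "\<lbrakk>i \<in> I; a \<in> group_part (D i)\<rbrakk> \<Longrightarrow> a \<turnstile>\<^bsub>D i\<^esub> e = a"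
  using digroup.group_part_ldot_unit digroups common_unit by metis

lemma group_part_carrier: "\<lbrakk>i \<in> I; a \<in> group_part (D i)\<rbrakk> \<Longrightarrow> a \<in> carrier (D i)"
  using digroup.group_part_carrier digroups by metis

lemma group_part_ldot_closed:
  "\<lbrakk>i \<in> I; a \<in> group_part (D i); b \<in> group_part (D i)\<rbrakk> \<Longrightarrow> a \<turnstile>\<^bsub>D i\<^esub> b \<in> group_part (D i)"
  using digroup.group_part_ldot_closed digroups by metis

lemma ldot_assoc:
  "\<lbrakk>i \<in> I; a \<in> carrier (D i); b \<in> carrier (D i); c \<in> carrier (D i)\<rbrakk>
    \<Longrightarrow> (a \<turnstile>\<^bsub>D i\<^esub> b) \<turnstile>\<^bsub>D i\<^esub> c = a \<turnstile>\<^bsub>D i\<^esub> (b \<turnstile>\<^bsub>D i\<^esub> c)"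
  using disemigroup.ldot_assoc digroup.axioms(1) digroups by metis

lemma idx_mem: "a \<in> L \<Longrightarrow> idx a \<in> I" "a \<in> L \<Longrightarrow> a \<in> carrier (D (idx a))"
  unfolding letters_def index_of_def
  by (metis (mono_tags, lifting) UN_E someI_ex)+

lemma idx_eq: "\<lbrakk>i \<in> I; a \<in> carrier (D i); a \<noteq> e\<rbrakk> \<Longrightarrow> idx a = i"
  using disjoint idx_mem[of a] by (auto simp: letters_def)

text \<open>Membership in \<open>J\<close> could come from another index; disjointness then leaves
  only \<open>e\<close>, which is in every group part.\<close>

lemma group_letter_iff: "\<lbrakk>i \<in> I; a \<in> carrier (D i)\<rbrakk> \<Longrightarrow> a \<in> J \<longleftrightarrow> a \<in> group_part (D i)"
  using idx_eq[of _ a] group_part_carrier unit_group_part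
  unfolding group_letters_def by (cases "a = e") blast+

lemma group_letters_subset: "a \<in> J \<Longrightarrow> a \<in> L"
  using group_part_carrier by (auto simp: group_letters_def letters_def)

lemma unit_group_letter [simp]: "e \<in> J"
  using nonempty unit_group_part by (auto simp: group_letters_def)

lemma unit_letter [simp]: "e \<in> L"
  by (simp add: group_letters_subset)

lemma group_part_letter: "\<lbrakk>i \<in> I; a \<in> group_part (D i)\<rbrakk> \<Longrightarrow> a \<in> J"
  by (auto simp: group_letters_def)

lemma carrier_letter: "\<lbrakk>i \<in> I; a \<in> carrier (D i)\<rbrakk> \<Longrightarrow> a \<in> L"
  by (auto simp: letters_def)

lemma idx_group_part: "a \<in> J \<Longrightarrow> a \<in> group_part (D (idx a))"
  using group_letter_iff group_letters_subset idx_mem by blast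

text \<open>Reduced words, except that the group unit is the empty word instead of \<open>[e]\<close>.\<close>

definition core :: "'a list set"
  where "core = {w \<in> lists (J - {e}). successively (\<lambda>a b. idx a \<noteq> idx b) w}"

definition avoids :: "'i \<Rightarrow> 'a list \<Rightarrow> bool"
  where "avoids i w \<longleftrightarrow> w = [] \<or> idx (hd w) \<noteq> i"

definition rword :: "'a list \<Rightarrow> 'a list"
  where "rword w = (if w = [] then [e] else w)"

text \<open>Adjoining \<open>e\<close> adds nothing, so words that begin in \<open>D i\<close> and
  words that do not take one common form: a letter of \<open>D i\<close>, possibly \<open>e\<close>,
  in front of a word that avoids \<open>i\<close>.\<close>

definition pre :: "'a \<Rightarrow> 'a list \<Rightarrow> 'a list"
  where "pre a w = (if a = e then w else a # w)"

definition post :: "'a list \<Rightarrow> 'a \<Rightarrow> 'a list"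
  where "post w a = (if a = e then w else w @ [a])"

text \<open>Van der Waerden's action of the letters on the normal forms.\<close>

definition act :: "'a \<Rightarrow> 'a list \<Rightarrow> 'a list"
  where "act a w =
    (if a = e then w
     else if avoids (idx a) w then a # w
     else pre (a \<turnstile>\<^bsub>D (idx a)\<^esub> hd w) (tl w))"

definition nf :: "'a list \<Rightarrow> 'a list"
  where "nf w = foldr act w []"

lemma core_Nil [simp]: "[] \<in> core"
  by (simp add: core_def)

lemma core_lists: "w \<in> core \<Longrightarrow> w \<in> lists J"
  by (auto simp: core_def)

lemma core_Cons: "a # w \<in> core \<longleftrightarrow> a \<in> J \<and> a \<noteq> e \<and> avoids (idx a) w \<and> w \<in> core"
  by (cases w) (auto simp: core_def avoids_def)

lemma avoids_rev: "avoids i (rev w) \<longleftrightarrow> w = [] \<or> idx (last w) \<noteq> i"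
  by (simp add: avoids_def hd_rev)

lemma core_rev [simp]: "rev w \<in> core \<longleftrightarrow> w \<in> core"
  by (auto simp: core_def successively_rev eq_commute)

lemma rev_pre: "rev (pre a w) = post (rev w) a"
  by (simp add: pre_def post_def)

lemma pre_core:
  "\<lbrakk>i \<in> I; a \<in> group_part (D i); w \<in> core; avoids i w\<rbrakk> \<Longrightarrow> pre a w \<in> core"
  using group_part_carrier idx_eq group_part_letter by (auto simp: pre_def core_Cons)

text \<open>These are coordinates on the normal forms: an element of the group part of
  \<open>D i\<close> and a normal form not beginning in \<open>D i\<close>. They replace case
  distinctions on the first letter.\<close>

lemma core_pre_cases:
  assumes "i \<in> I" "w \<in> core"
  obtains b w' where "b \<in> group_part (D i)" "w' \<in> core" "avoids i w'" "w = pre b w'"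
proof (cases "avoids i w")
  case True
  then show ?thesis
    using that[of e w] assms by (simp add: pre_def)
next
  case False
  then obtain b w' where "w = b # w'" "idx b = i"
    by (cases w) (auto simp: avoids_def)
  then show ?thesis
    using that[of b w'] assms idx_group_part by (auto simp: core_Cons pre_def)
qed

text \<open>The action works at the left end only; the splitting at the right end comes from
  reversal, which preserves \<open>core\<close>.\<close>

lemma core_post_cases:
  assumes "i \<in> I" "w \<in> core"
  obtains b w' where "b \<in> group_part (D i)" "w' \<in> core" "avoids i (rev w')" "w = post w' b"
proof -
  obtain b w' where "b \<in> group_part (D i)" "w' \<in> core" "avoids i w'" "rev w = pre b w'"
    using core_pre_cases[of i "rev w"] assms by auto
  then show ?thesis
    using that[of b "rev w'"] by (metis core_rev rev_pre rev_rev_ident)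
qed

text \<open>In the coordinates of \<open>core_pre_cases\<close> the action of \<open>D i\<close> is
  left multiplication on the first one. The index is a parameter because \<open>idx e\<close> is an
  arbitrary choice.\<close>

lemma act_pre:
  assumes "i \<in> I" "a \<in> group_part (D i)" "b \<in> group_part (D i)" "w \<in> core" "avoids i w"
  shows "act a (pre b w) = pre (a \<turnstile>\<^bsub>D i\<^esub> b) w"
proof (cases "a = e")
  case True
  then show ?thesis
    using assms group_part_carrier by (simp add: act_def)
next
  case False
  then have "idx a = i"
    using assms group_part_carrier idx_eq by blast
  moreover have "idx b = i" if "b \<noteq> e"
    using assms that group_part_carrier idx_eq by blast
  ultimately show ?thesis
    using assms False by (auto simp: act_def pre_def avoids_def)
qed

lemma act_core:
  assumes "a \<in> J" "w \<in> core"
  shows "act a w \<in> core"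
proof -
  have i: "idx a \<in> I" "a \<in> group_part (D (idx a))"
    using assms idx_group_part idx_mem group_letters_subset by auto
  obtain b w' where "b \<in> group_part (D (idx a))" "w' \<in> core" "avoids (idx a) w'" "w = pre b w'"
    using core_pre_cases[OF i(1) assms(2)] .
  then show ?thesis
    using i by (simp add: act_pre pre_core group_part_ldot_closed)
qed

text \<open>By \<open>act_pre\<close> this is associativity in \<open>D i\<close>. It says that the
  action respects the multiplication relation of the free product.\<close>

lemma act_act:
  assumes "i \<in> I" "a \<in> group_part (D i)" "b \<in> group_part (D i)" "w \<in> core"
  shows "act a (act b w) = act (a \<turnstile>\<^bsub>D i\<^esub> b) w"
proof -
  obtain c w' where "c \<in> group_part (D i)" "w' \<in> core" "avoids i w'" "w = pre c w'"
    using core_pre_cases[OF assms(1,4)] .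
  then show ?thesis
    using assms by (simp add: act_pre group_part_ldot_closed ldot_assoc group_part_carrier)
qed

lemma act_unit [simp]: "act e w = w"
  by (simp add: act_def)

lemma foldr_act_core: "\<lbrakk>u \<in> lists J; w \<in> core\<rbrakk> \<Longrightarrow> foldr act u w \<in> core"
  by (induction u) (auto simp: act_core)

lemma nf_core: "u \<in> lists J \<Longrightarrow> nf u \<in> core"
  by (simp add: nf_def foldr_act_core)

lemma nf_Nil [simp]: "nf [] = []"
  by (simp add: nf_def)

lemma nf_unit [simp]: "nf [e] = []"
  by (simp add: nf_def)

lemma act_avoids: "avoids (idx a) w \<Longrightarrow> act a w = pre a w"
  by (simp add: act_def pre_def)

lemma nf_of_core: "w \<in> core \<Longrightarrow> nf w = w"
  by (induction w) (simp_all add: nf_def core_Cons act_avoids pre_def)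

text \<open>Reducing the acting word does not change its effect: the only change is at its front,
  where two letters of one \<open>D i\<close> are multiplied, and \<open>act_act\<close> covers
  this.\<close>

lemma foldr_act_act:
  assumes "a \<in> J" "z \<in> core" "w \<in> core"
  shows "foldr act (act a z) w = act a (foldr act z w)"
proof -
  have i: "idx a \<in> I" "a \<in> group_part (D (idx a))"
    using assms idx_group_part idx_mem group_letters_subset by auto
  have pre: "foldr act (pre b z') w = act b (foldr act z' w)" for b z'
    by (simp add: pre_def)
  obtain b z' where "b \<in> group_part (D (idx a))" "z' \<in> core" "avoids (idx a) z'" "z = pre b z'"
    using core_pre_cases[OF i(1) assms(2)] .
  then show ?thesis
    using i assms by (simp add: act_pre pre act_act foldr_act_core core_lists)
qed

lemma foldr_act_nf: "\<lbrakk>u \<in> lists J; w \<in> core\<rbrakk> \<Longrightarrow> foldr act (nf u) w = foldr act u w"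
proof (induction u)
  case (Cons a u)
  then have "foldr act (act a (nf u)) w = act a (foldr act (nf u) w)"
    by (intro foldr_act_act) (auto simp: nf_core)
  with Cons show ?case
    by (simp add: nf_def)
qed simp

lemma nf_append: "nf (u @ v) = foldr act u (nf v)"
  by (simp add: nf_def)

text \<open>The right factor enters \<open>nf (u @ v)\<close> only through its normal form by
  definition; for the left factor this is \<open>foldr_act_nf\<close>. Any factor of a word may thus
  be exchanged for an equivalent one.\<close>

lemma nf_append_cong:
  "\<lbrakk>u \<in> lists J; u' \<in> lists J; v \<in> lists J; v' \<in> lists J; nf u = nf u'; nf v = nf v'\<rbrakk>
    \<Longrightarrow> nf (u @ v) = nf (u' @ v')"
  by (metis nf_append foldr_act_nf nf_core)

lemma nf_nf: "u \<in> lists J \<Longrightarrow> nf (nf u) = nf u"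
  by (simp add: nf_core nf_of_core)

lemma nf_post:
  "nf (post w a) = nf (w @ [a])"
  by (simp add: post_def nf_def)

lemma nf_pre: "nf (pre a w) = nf (a # w)"
  by (simp add: pre_def nf_def)

lemma nf_rword: "nf (rword w) = nf w"
  by (simp add: rword_def)

lemma post_core:
  "\<lbrakk>i \<in> I; a \<in> group_part (D i); w \<in> core; avoids i (rev w)\<rbrakk> \<Longrightarrow> post w a \<in> core"
  by (metis core_rev rev_pre rev_rev_ident pre_core)

lemma group_part_nf2:
  "\<lbrakk>i \<in> I; a \<in> group_part (D i); b \<in> group_part (D i); v \<in> lists J\<rbrakk>
    \<Longrightarrow> nf (u @ a # b # v) = nf (u @ (a \<turnstile>\<^bsub>D i\<^esub> b) # v)"
  using act_act[of i a b "nf v"] nf_core by (simp add: nf_def)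

text \<open>Right-hand counterpart of \<open>act_pre\<close>. As nothing acts from the right, the
  two last letters are multiplied inside the word before it is evaluated.\<close>

lemma nf_post_snoc:
  assumes "i \<in> I" "a \<in> group_part (D i)" "b \<in> group_part (D i)" "w \<in> core" "avoids i (rev w)"
  shows "nf (post w a @ [b]) = post w (a \<turnstile>\<^bsub>D i\<^esub> b)"
proof -
  have "nf (post w a @ [b]) = nf (w @ [a, b])"
    by (simp add: post_def nf_def)
  also have "\<dots> = nf (w @ [a \<turnstile>\<^bsub>D i\<^esub> b])"
    using group_part_nf2[of i a b "[]" w] assms by simp
  also have "\<dots> = nf (post w (a \<turnstile>\<^bsub>D i\<^esub> b))"
    by (simp add: nf_post)
  also have "\<dots> = post w (a \<turnstile>\<^bsub>D i\<^esub> b)"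
    using assms by (simp add: nf_of_core post_core group_part_ldot_closed)
  finally show ?thesis .
qed


section \<open>Normal forms and the congruence classes of the free product\<close>

lemma monoid_group_parts: "\<forall>i\<in>I. monoid (group_parts D i)"
  by (auto simp: group_parts_def group_part_group_def common_unit group_part_ldot_closed
    ldot_assoc group_part_carrier intro!: monoidI)

lemma group_parts_simps [simp]:
  "carrier (group_parts D i) = group_part (D i)"
  "(\<otimes>\<^bsub>group_parts D i\<^esub>) = (\<turnstile>\<^bsub>D i\<^esub>)"
  "i \<in> I \<Longrightarrow> \<one>\<^bsub>group_parts D i\<^esub> = e"
  by (simp_all add: group_parts_def group_part_group_def common_unit)

abbreviation FW where "FW \<equiv> free_product_words I (group_parts D)"
abbreviation FR where "FR \<equiv> free_product_rel I (group_parts D)"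

definition tag :: "'a list \<Rightarrow> ('i \<times> 'a) list"
  where "tag = map (\<lambda>a. (idx a, a))"

lemma tag_simps [simp]: "tag [] = []" "tag (a # w) = (idx a, a) # tag w" "tag (v @ w) = tag v @ tag w"
  by (simp_all add: tag_def)

lemma tag_words: "w \<in> lists J \<Longrightarrow> tag w \<in> FW"
  by (induction w) (auto simp: idx_group_part idx_mem group_letters_subset)

lemma free_product_words_lists: "w \<in> FW \<Longrightarrow> map snd w \<in> lists J"
  by (induction w) (auto simp: group_part_letter)

text \<open>The defining relations hold for the action, by \<open>act_act\<close> and because
  \<open>e\<close> acts as the identity; hence the normal form depends only on the class.\<close>

lemma free_product_rel_act:
  assumes "(v, w) \<in> FR" "z \<in> core"
  shows "foldr act (map snd v) z = foldr act (map snd w) z"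
  using assms
proof (induction rule: free_product_rel.induct)
  case (mult p q i a b)
  have "foldr act (map snd q) z \<in> core"
    using mult by (simp add: foldr_act_core free_product_words_lists)
  then show ?case
    using mult by (simp add: act_act)
qed auto

lemma free_product_rel_Cons:
  "\<lbrakk>(v, w) \<in> FR; i \<in> I; a \<in> group_part (D i)\<rbrakk> \<Longrightarrow> ((i, a) # v, (i, a) # w) \<in> FR"
  using free_product_rel_append[of v w I "group_parts D" "[(i, a)]" "[]"] by simp

text \<open>One step of the action can be performed with the defining relations: split off the
  leading letter of index \<open>idx a\<close>, multiply it by \<open>a\<close>, and delete the
  product if it is trivial.\<close>

lemma tag_act_rel:
  assumes "a \<in> J" "w \<in> core"
  shows "((idx a, a) # tag w, tag (act a w)) \<in> FR"
proof -
  have i: "idx a \<in> I" "a \<in> group_part (D (idx a))"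
    using assms idx_group_part idx_mem group_letters_subset by auto
  have unit: "((idx a, e) # tag v, tag v) \<in> FR" if "v \<in> core" for v
    using free_product_rel.one[of "[]" I "group_parts D" "tag v" "idx a"] i that
    by (simp add: tag_words core_lists)
  \<comment> \<open>The tag of \<open>b\<close> is \<open>idx a\<close> unless \<open>b\<close> is
    \<open>e\<close>; in that case its tag is immaterial, since the letter is deleted.\<close>
  have pre: "((idx a, b) # tag v, tag (pre b v)) \<in> FR"
    if "b \<in> group_part (D (idx a))" "v \<in> core" for b v
  proof (cases "b = e")
    case False
    moreover have "idx b = idx a"
      using False that i idx_eq group_part_carrier by blast
    ultimately show ?thesis
      using that i by (auto simp: pre_def intro!: free_product_rel.refl tag_words core_lists)
  qed (use that unit in \<open>simp add: pre_def\<close>)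
  obtain b w' where b: "b \<in> group_part (D (idx a))" "w' \<in> core" "avoids (idx a) w'" "w = pre b w'"
    using core_pre_cases[OF i(1) assms(2)] .
  have "((idx a, a) # tag w, (idx a, a) # (idx a, b) # tag w') \<in> FR"
    using b i by (auto intro: free_product_rel_Cons free_product_rel.sym pre)
  moreover have "((idx a, a) # (idx a, b) # tag w', (idx a, a \<turnstile>\<^bsub>D (idx a)\<^esub> b) # tag w') \<in> FR"
    using b i free_product_rel.mult[of "[]" I "group_parts D" "tag w'" "idx a" a b]
    by (simp add: tag_words core_lists)
  moreover have "((idx a, a \<turnstile>\<^bsub>D (idx a)\<^esub> b) # tag w', tag (act a w)) \<in> FR"
    using b i by (auto simp: act_pre intro!: pre group_part_ldot_closed)
  ultimately show ?thesis
    by (blast intro: free_product_rel.trans)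
qed

lemma tag_nf_rel: "w \<in> lists J \<Longrightarrow> (tag w, tag (nf w)) \<in> FR"
proof (induction w)
  case (Cons a w)
  have "((idx a, a) # tag w, (idx a, a) # tag (nf w)) \<in> FR"
    using Cons by (auto intro!: free_product_rel_Cons simp: idx_mem idx_group_part group_letters_subset)
  moreover have "((idx a, a) # tag (nf w), tag (act a (nf w))) \<in> FR"
    using Cons by (auto intro!: tag_act_rel nf_core)
  ultimately show ?case
    by (auto simp: nf_def intro: free_product_rel.trans)
qed (simp add: free_product_rel.refl)

lemma represented_tag: "represented I D w = free_product_class I (group_parts D) (tag w)"
  by (simp add: represented_def tag_def)

text \<open>Related words move the empty normal form to the same place; conversely
  \<open>tag_nf_rel\<close> relates each word to its normal form. This yields uniqueness and
  existence of reduced representatives.\<close>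

lemma represented_eq_iff:
  assumes "v \<in> lists J" "w \<in> lists J"
  shows "represented I D v = represented I D w \<longleftrightarrow> nf v = nf w"
proof -
  have "represented I D v = represented I D w \<longleftrightarrow> (tag v, tag w) \<in> FR"
    unfolding represented_tag free_product_class_def
    using eq_equiv_class_iff[OF equiv_free_product_rel[OF monoid_group_parts]] tag_words assms by simp
  also have "\<dots> \<longleftrightarrow> nf v = nf w"
  proof
    assume "(tag v, tag w) \<in> FR"
    from free_product_rel_act[OF this, of "[]"] show "nf v = nf w"
      by (simp add: nf_def tag_def comp_def)
  next
    assume "nf v = nf w"
    then show "(tag v, tag w) \<in> FR"
      using tag_nf_rel assms by (metis free_product_rel.sym free_product_rel.trans)
  qed
  finally show ?thesis .
qed

lemma reduced_words_eq: "reduced_words I D e = rword ` core"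
proof (intro equalityI subsetI)
  fix w assume "w \<in> reduced_words I D e"
  then have "w = rword [] \<or> w = rword w \<and> w \<in> core"
    by (auto simp: reduced_words_def good_words_def rword_def core_def)
  then show "w \<in> rword ` core"
    using core_Nil by blast
next
  fix w assume "w \<in> rword ` core"
  then show "w \<in> reduced_words I D e"
    using group_letters_subset
    by (auto simp: reduced_words_def good_words_def rword_def core_def)
qed

lemma rword_lists: "w \<in> lists J \<Longrightarrow> rword w \<in> lists J"
  by (simp add: rword_def)

lemma reduce_eq:
  assumes "u \<in> lists J"
  shows "reduce I D e u = rword (nf u)"
  unfolding reduce_def
proof (rule the_equality)
  show "rword (nf u) \<in> reduced_words I D e \<and> represented I D (rword (nf u)) = represented I D u"
    using assms
    by (simp add: reduced_words_eq nf_core represented_eq_iff rword_lists core_lists nf_rword nf_nf)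
next
  fix w assume w: "w \<in> reduced_words I D e \<and> represented I D w = represented I D u"
  then obtain c where c: "c \<in> core" "w = rword c"
    by (auto simp: reduced_words_eq)
  then have "nf w = nf u"
    using w assms by (simp add: represented_eq_iff rword_lists core_lists)
  then show "w = rword (nf u)"
    using c by (simp add: nf_rword nf_of_core)
qed

end


section \<open>Center-words\<close>

context digroup_family
begin

abbreviation S where "S \<equiv> sharp I D e"

lemma sharp_eq: "\<lbrakk>i \<in> I; a \<in> carrier (D i)\<rbrakk> \<Longrightarrow> S a = a \<turnstile>\<^bsub>D i\<^esub> e"
  using idx_eq[of i a] idx_mem[OF unit_letter] by (cases "a = e") (auto simp: sharp_def)

lemma sharp_group_part: "\<lbrakk>i \<in> I; a \<in> carrier (D i)\<rbrakk> \<Longrightarrow> S a \<in> group_part (D i)"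
  using digroup.ldot_unit_group_part digroups common_unit sharp_eq by metis

lemma sharp_group_letter: "a \<in> L \<Longrightarrow> S a \<in> J"
  using sharp_group_part group_part_letter idx_mem by metis

lemma sharp_id: "a \<in> J \<Longrightarrow> S a = a"
  by (simp add: sharp_def idx_group_part idx_mem group_letters_subset)

lemma sharp_word_id: "w \<in> lists J \<Longrightarrow> sharp_word I D e w = rword w"
  by (auto simp: sharp_word_def rword_def sharp_id intro: map_idI)

lemma reduce_core: "w \<in> core \<Longrightarrow> reduce I D e w = rword w"
  by (simp add: reduce_eq core_lists nf_of_core)

lemma reduce_cong:
  "\<lbrakk>u \<in> lists J; v \<in> lists J; nf u = nf v\<rbrakk> \<Longrightarrow> reduce I D e u = reduce I D e v"
  by (simp add: reduce_eq)

lemma reduce_ne_Nil: "u \<in> lists J \<Longrightarrow> reduce I D e u \<noteq> []"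
  by (simp add: reduce_eq rword_def)

lemma ldot_rdot_eq_ldot_ldot:
  "\<lbrakk>i \<in> I; a \<in> group_part (D i); b \<in> group_part (D i); c \<in> group_part (D i)\<rbrakk>
    \<Longrightarrow> (a \<turnstile>\<^bsub>D i\<^esub> b) \<stileturn>\<^bsub>D i\<^esub> c = a \<turnstile>\<^bsub>D i\<^esub> (b \<turnstile>\<^bsub>D i\<^esub> c)"
  using digroup.ldot_rdot_eq_ldot_ldot digroups by metis

text \<open>For the sharp, \<open>((l \<turnstile> a) \<stileturn> r) \<turnstile> e = ((l
  \<turnstile> a) \<turnstile> r) \<turnstile> e\<close>, and the final \<open>e\<close> is
  swallowed by \<open>r\<close>. Thus absorbed letters reappear in the sharp as ordinary
  factors.\<close>

lemma center_closed:
  assumes "i \<in> I" "a \<in> carrier (D i)" "l \<in> group_part (D i)" "r \<in> group_part (D i)"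
  shows "(l \<turnstile>\<^bsub>D i\<^esub> a) \<stileturn>\<^bsub>D i\<^esub> r \<in> carrier (D i)"
    and "(l \<turnstile>\<^bsub>D i\<^esub> a) \<stileturn>\<^bsub>D i\<^esub> r \<in> J \<longleftrightarrow> a \<in> J"
    and "S ((l \<turnstile>\<^bsub>D i\<^esub> a) \<stileturn>\<^bsub>D i\<^esub> r) = l \<turnstile>\<^bsub>D i\<^esub> (S a \<turnstile>\<^bsub>D i\<^esub> r)"
proof -
  interpret Di: digroup "D i"
    using assms digroups by blast
  show carrier: "(l \<turnstile>\<^bsub>D i\<^esub> a) \<stileturn>\<^bsub>D i\<^esub> r \<in> carrier (D i)"
    using assms by (simp add: Di.ldot_closed Di.rdot_closed)
  show "(l \<turnstile>\<^bsub>D i\<^esub> a) \<stileturn>\<^bsub>D i\<^esub> r \<in> J \<longleftrightarrow> a \<in> J"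
    using assms carrier group_letter_iff
    by (simp add: Di.ldot_closed Di.rdot_group_part_iff Di.ldot_group_part_iff)
  show "S ((l \<turnstile>\<^bsub>D i\<^esub> a) \<stileturn>\<^bsub>D i\<^esub> r) = l \<turnstile>\<^bsub>D i\<^esub> (S a \<turnstile>\<^bsub>D i\<^esub> r)"
    using assms carrier
    by (simp add: sharp_eq Di.ldot_rdot Di.ldot_assoc Di.ldot_closed)
qed

lemma hd_core: "\<lbrakk>w \<in> core; w \<noteq> []\<rbrakk> \<Longrightarrow> hd w \<in> J \<and> hd w \<noteq> e"
  by (cases w) (auto simp: core_Cons)

lemma last_core: "\<lbrakk>w \<in> core; w \<noteq> []\<rbrakk> \<Longrightarrow> last w \<in> J \<and> last w \<noteq> e"
  using hd_core[of "rev w"] by (simp add: hd_rev)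

text \<open>Allowing \<open>l\<close> and \<open>r\<close> to be \<open>e\<close> merges the four
  cases of the bracket. If a side is the reduced word \<open>[e]\<close>, the bracket does absorb
  this \<open>e\<close>, since it lies in \<open>D i\<close>, and the center is unaffected.\<close>

lemma bracket_post_pre:
  assumes "i \<in> I" "a \<in> carrier (D i)" "a \<notin> J"
    and "u \<in> core" "avoids i (rev u)" "l \<in> group_part (D i)"
    and "v \<in> core" "avoids i v" "r \<in> group_part (D i)"
  shows "bracket I D (rword (post u l)) a (rword (pre r v))
    = (u, (l \<turnstile>\<^bsub>D i\<^esub> a) \<stileturn>\<^bsub>D i\<^esub> r, v)"
proof -
  have "a \<noteq> e"
    using assms by auto
  then have i: "idx a = i"
    using assms idx_eq by blast
  have u: "last u \<notin> carrier (D i)" if "u \<noteq> []"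
    using that last_core[of u] assms idx_eq[of i "last u"] by (auto simp: avoids_rev)
  have v: "hd v \<notin> carrier (D i)" if "v \<noteq> []"
    using that hd_core[of v] assms idx_eq[of i "hd v"] by (auto simp: avoids_def)
  have c: "l \<turnstile>\<^bsub>D i\<^esub> a \<in> carrier (D i)" "l \<in> carrier (D i)" "r \<in> carrier (D i)"
    using assms disemigroup.ldot_closed digroup.axioms(1) digroups group_part_carrier by metis+
  show ?thesis
    using assms c u v
    by (auto simp: bracket_def i post_def pre_def rword_def Let_def)
qed

definition cw :: "'a list \<Rightarrow> 'a \<Rightarrow> 'a list \<Rightarrow> 'a center_word"
  where "cw u a v =
    (if a \<in> J then group_bracket (reduce I D e (u @ [a] @ v))
     else bracket I D (reduce I D e u) a (reduce I D e v))"

lemma cw_cong: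
  assumes "u \<in> lists J" "u' \<in> lists J" "v \<in> lists J" "v' \<in> lists J" "nf u = nf u'" "nf v = nf v'"
  shows "cw u a v = cw u' a v'"
proof -
  have "nf (u @ [a] @ v) = nf (u' @ [a] @ v')" if "a \<in> J"
    using that assms by (intro nf_append_cong) (simp_all add: nf_append)
  then show ?thesis
    using assms by (simp add: cw_def reduce_eq)
qed

lemma cw_decompose:
  assumes "u \<in> lists J" "v \<in> lists J" "i \<in> I" "a \<in> carrier (D i)" "a \<notin> J"
  obtains p l r q where "p \<in> core" "avoids i (rev p)" "l \<in> group_part (D i)" "nf u = post p l"
    "q \<in> core" "avoids i q" "r \<in> group_part (D i)" "nf v = pre r q"
    "cw u a v = (p, (l \<turnstile>\<^bsub>D i\<^esub> a) \<stileturn>\<^bsub>D i\<^esub> r, q)"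
proof -
  obtain p l where p: "l \<in> group_part (D i)" "p \<in> core" "avoids i (rev p)" "nf u = post p l"
    using core_post_cases[OF assms(3), of "nf u"] assms nf_core by metis
  obtain q r where q: "r \<in> group_part (D i)" "q \<in> core" "avoids i q" "nf v = pre r q"
    using core_pre_cases[OF assms(3), of "nf v"] assms nf_core by metis
  have "cw u a v = (p, (l \<turnstile>\<^bsub>D i\<^esub> a) \<stileturn>\<^bsub>D i\<^esub> r, q)"
    using p q assms bracket_post_pre[of i a p l q r] by (simp add: cw_def reduce_eq)
  with p q that show ?thesis
    by blast
qed

lemma cw_group: "\<lbrakk>u \<in> lists J; v \<in> lists J; a \<in> J\<rbrakk> \<Longrightarrow>
    \<exists>c q. rword (nf (u @ [a] @ v)) = c # q \<and> c \<in> J \<and> q \<in> core \<and> cw u a v = ([], c, q)"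
proof -
  assume *: "u \<in> lists J" "v \<in> lists J" "a \<in> J"
  then have "nf (u @ [a] @ v) \<in> core"
    by (simp add: nf_core)
  then show ?thesis
    using * by (cases "nf (u @ [a] @ v)") (auto simp: cw_def reduce_eq rword_def group_bracket_def core_Cons)
qed

lemma good_words_eq:
  "w \<in> good_words I D e \<longleftrightarrow> w = [e] \<or>
    (w \<noteq> [] \<and> w \<in> lists (L - {e}) \<and> successively (\<lambda>a b. idx a \<noteq> idx b) w)"
  by (auto simp: good_words_def)

lemma center_words_iff:
  "(u, a, v) \<in> center_words I D e \<longleftrightarrow>
    (if a \<in> J then u = [] \<and> a # v \<in> rword ` core
     else u \<in> core \<and> v \<in> core \<and> a \<in> L \<and> avoids (idx a) (rev u) \<and> avoids (idx a) v)"
proof (cases "a \<in> J")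
  case True
  have "(u, a, v) \<in> center_words I D e \<longleftrightarrow> u = [] \<and> a # v \<in> reduced_words I D e"
    using True group_letters_subset by (auto simp: center_words_def reduced_words_def)
  then show ?thesis
    using True reduced_words_eq by simp
next
  case False
  then have "a \<noteq> e"
    by auto
  have J: "w \<in> lists J \<and> w \<in> lists (L - {e}) \<longleftrightarrow> w \<in> lists (J - {e})" for w
    using group_letters_subset by auto
  have good: "u @ [a] @ v \<in> good_words I D e \<longleftrightarrow>
      u \<in> lists (L - {e}) \<and> a \<in> L \<and> v \<in> lists (L - {e}) \<and>
      successively (\<lambda>a b. idx a \<noteq> idx b) u \<and> successively (\<lambda>a b. idx a \<noteq> idx b) v \<and>
      avoids (idx a) (rev u) \<and> avoids (idx a) v"
    using \<open>a \<noteq> e\<close>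
    by (cases v; cases u rule: rev_cases)
      (auto simp: good_words_eq avoids_rev avoids_def successively_append_iff)
  show ?thesis
    by (simp only: center_words_def core_def mem_Collect_eq prod.case good False if_False
      flip: J) argo
qed

lemma center_wordsD:
  assumes "(u, a, v) \<in> center_words I D e"
  shows "u \<in> core" "v \<in> core" "u \<in> lists J" "v \<in> lists J" "a \<in> L"
proof -
  have "u \<in> core \<and> v \<in> core \<and> a \<in> L"
    using assms group_letters_subset
    by (auto simp: center_words_iff rword_def core_Cons split: if_splits)
  then show "u \<in> core" "v \<in> core" "u \<in> lists J" "v \<in> lists J" "a \<in> L"
    by (auto simp: core_lists)
qed

lemma cw_center_words:
  assumes "u \<in> lists J" "v \<in> lists J" "a \<in> L"
  shows "cw u a v \<in> center_words I D e"
proof (cases "a \<in> J")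
  case True
  have "rword (nf (u @ [a] @ v)) \<in> rword ` core"
    using assms True by (simp add: nf_core)
  then show ?thesis
    using cw_group[OF assms(1,2) True] by (auto simp: center_words_iff)
next
  case False
  have i: "idx a \<in> I" "a \<in> carrier (D (idx a))"
    using assms idx_mem by auto
  obtain p l r q where *: "p \<in> core" "avoids (idx a) (rev p)" "l \<in> group_part (D (idx a))" "nf u = post p l"
    "q \<in> core" "avoids (idx a) q" "r \<in> group_part (D (idx a))" "nf v = pre r q"
    "cw u a v = (p, (l \<turnstile>\<^bsub>D (idx a)\<^esub> a) \<stileturn>\<^bsub>D (idx a)\<^esub> r, q)"
    using cw_decompose[OF assms(1,2) i False] .
  define c where "c = (l \<turnstile>\<^bsub>D (idx a)\<^esub> a) \<stileturn>\<^bsub>D (idx a)\<^esub> r"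
  have c: "c \<in> carrier (D (idx a))" "c \<notin> J"
    using center_closed[OF i *(3,7)] False by (auto simp: c_def)
  then have "idx c = idx a"
    using idx_eq[of "idx a" c] i unit_group_letter by metis
  with c show ?thesis
    using * c i carrier_letter[of "idx a" c] by (auto simp: center_words_iff c_def)
qed

lemma cw_of_center_word:
  assumes "(u, a, v) \<in> center_words I D e"
  shows "cw u a v = (u, a, v)"
proof (cases "a \<in> J")
  case True
  then obtain w where w: "u = []" "a # v = rword w" "w \<in> core"
    using assms by (auto simp: center_words_iff)
  have "reduce I D e (a # v) = a # v"
    using w by (simp add: reduce_eq rword_lists core_lists nf_rword nf_of_core)
  then show ?thesis
    using True w(1) by (simp add: cw_def group_bracket_def)
next
  case False
  then have *: "u \<in> core" "v \<in> core" "a \<in> L" "avoids (idx a) (rev u)" "avoids (idx a) v"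
    using assms by (auto simp: center_words_iff)
  then have "bracket I D (rword (post u e)) a (rword (pre e v)) =
      (u, (e \<turnstile>\<^bsub>D (idx a)\<^esub> a) \<stileturn>\<^bsub>D (idx a)\<^esub> e, v)"
    using False by (intro bracket_post_pre) (auto simp: idx_mem)
  then show ?thesis
    using * False by (simp add: cw_def reduce_core pre_def post_def idx_mem)
qed

text \<open>The outer words carry no reducedness condition here, so that identities on all
  center-words can be checked on freely concatenated ones.\<close>

lemma center_word_cases:
  assumes "x \<in> center_words I D e"
  obtains u a v where "u \<in> lists J" "a \<in> L" "v \<in> lists J" "x = cw u a v"
  using assms center_wordsD cw_of_center_word by (cases x) metis

text \<open>Outside \<open>J\<close>, bracketing replaces \<open>a\<close> by
  \<open>(l \<turnstile> a) \<stileturn> r\<close>, whose sharp is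
  \<open>l \<turnstile> (S a \<turnstile> r)\<close>, so the group element of the whole word is
  unchanged. This element is all that \<turnstile> retains of its left argument and \<stileturn> of
  its right one.\<close>

lemma cw_sharp:
  assumes "u \<in> lists J" "v \<in> lists J" "a \<in> L" "cw u a v = (p, c, q)"
  shows "nf (p @ [S c] @ q) = nf (u @ [S a] @ v)"
proof (cases "a \<in> J")
  case True
  obtain c' q' where c: "rword (nf (u @ [a] @ v)) = c' # q'" "c' \<in> J" "cw u a v = ([], c', q')"
    using cw_group[OF assms(1,2) True] by blast
  then have "nf (c # q) = nf (u @ [a] @ v)"
    using assms True nf_rword[of "nf (u @ [a] @ v)"] nf_nf[of "u @ [a] @ v"] by simp
  then show ?thesis
    using c assms True by (simp add: sharp_id)
next
  case False
  have i: "idx a \<in> I" "a \<in> carrier (D (idx a))"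
    using assms idx_mem by auto
  obtain p' l r q' where *: "p' \<in> core" "avoids (idx a) (rev p')" "l \<in> group_part (D (idx a))" "nf u = post p' l"
    "q' \<in> core" "avoids (idx a) q'" "r \<in> group_part (D (idx a))" "nf v = pre r q'"
    "cw u a v = (p', (l \<turnstile>\<^bsub>D (idx a)\<^esub> a) \<stileturn>\<^bsub>D (idx a)\<^esub> r, q')"
    using cw_decompose[OF assms(1,2) i False] .
  then have eq: "p = p'" "c = (l \<turnstile>\<^bsub>D (idx a)\<^esub> a) \<stileturn>\<^bsub>D (idx a)\<^esub> r" "q = q'"
    using assms by auto
  have Sa: "S a \<in> group_part (D (idx a))"
    using i sharp_group_part by blast
  have lists: "p \<in> lists J" "q \<in> lists J" "S a \<in> J" "l \<in> J" "r \<in> J"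
    using * i Sa eq by (auto simp: core_lists group_part_letter)
  have "nf (p @ [S c] @ q) = nf (p @ l # (S a \<turnstile>\<^bsub>D (idx a)\<^esub> r) # q)"
    using eq center_closed(3)[OF i *(3,7)]
      group_part_nf2[of "idx a" l "S a \<turnstile>\<^bsub>D (idx a)\<^esub> r" q p] i * Sa lists
    by (simp add: group_part_ldot_closed)
  also have "\<dots> = nf (p @ l # S a # r # q)"
    using group_part_nf2[of "idx a" "S a" r q "p @ [l]"] i * Sa lists by simp
  also have "\<dots> = nf ((p @ [l]) @ [S a] @ (r # q))"
    by simp
  also have "\<dots> = nf (u @ [S a] @ v)"
  proof (intro nf_append_cong)
    show "nf (p @ [l]) = nf u"
      using * eq nf_post[of p l] nf_nf assms by metis
    show "nf (r # q) = nf v"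
      using * eq nf_pre[of r q] nf_nf assms by metis
  qed (use lists assms in auto)
  finally show ?thesis .
qed

text \<open>For a center in \<open>J\<close> only the whole word counts. Otherwise both sides have
  the same outer words left after absorption, and their centers agree by the laws of
  \<open>D i\<close>.\<close>

lemma cw_post_pre:
  assumes i: "i \<in> I" "a \<in> carrier (D i)" "l \<in> group_part (D i)" "r \<in> group_part (D i)"
    and "u \<in> lists J" "v \<in> lists J"
  shows "cw (u @ [l]) a (r # v) = cw u ((l \<turnstile>\<^bsub>D i\<^esub> a) \<stileturn>\<^bsub>D i\<^esub> r) v"
proof (cases "a \<in> J")
  case True
  define c where "c = (l \<turnstile>\<^bsub>D i\<^esub> a) \<stileturn>\<^bsub>D i\<^esub> r"
  have a: "a \<in> group_part (D i)"
    using True i group_letter_iff by blast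
  then have c: "c = l \<turnstile>\<^bsub>D i\<^esub> (a \<turnstile>\<^bsub>D i\<^esub> r)" "c \<in> J"
    using i center_closed(2)[OF i] True by (simp_all add: c_def ldot_rdot_eq_ldot_ldot)
  have J: "l \<in> J" "r \<in> J"
    using i group_part_letter by auto
  have "nf (u @ l # a # r # v) = nf (u @ l # (a \<turnstile>\<^bsub>D i\<^esub> r) # v)"
    using group_part_nf2[of i a r v "u @ [l]"] assms a by simp
  also have "\<dots> = nf (u @ c # v)"
    unfolding c using group_part_nf2[of i l "a \<turnstile>\<^bsub>D i\<^esub> r" v u] assms a
    by (simp add: group_part_ldot_closed)
  finally have "nf (u @ l # a # r # v) = nf (u @ c # v)" .
  then show ?thesis
    using True c(2) J assms by (simp add: cw_def reduce_eq flip: c_def)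
next
  case False
  define c where "c = (l \<turnstile>\<^bsub>D i\<^esub> a) \<stileturn>\<^bsub>D i\<^esub> r"
  have c: "c \<in> carrier (D i)" "c \<notin> J"
    using center_closed[OF i] False by (auto simp: c_def)
  have J: "l \<in> J" "r \<in> J"
    using i group_part_letter by auto
  obtain p l' r' q where *: "p \<in> core" "avoids i (rev p)" "l' \<in> group_part (D i)" "nf u = post p l'"
    "q \<in> core" "avoids i q" "r' \<in> group_part (D i)" "nf v = pre r' q"
    "cw u c v = (p, (l' \<turnstile>\<^bsub>D i\<^esub> c) \<stileturn>\<^bsub>D i\<^esub> r', q)"
    using cw_decompose[OF assms(5,6) i(1) c] .
  have "nf (u @ [l]) = nf (post p l' @ [l])"
    using * assms J nf_nf[of u] nf_core[of u] by (intro nf_append_cong) (auto simp: core_lists)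
  then have ul: "nf (u @ [l]) = post p (l' \<turnstile>\<^bsub>D i\<^esub> l)"
    using * i by (simp add: nf_post_snoc)
  have "nf (r # v) = act r (nf v)"
    by (simp add: nf_def)
  then have rv: "nf (r # v) = pre (r \<turnstile>\<^bsub>D i\<^esub> r') q"
    using * i by (simp add: act_pre)
  interpret Di: digroup "D i"
    using i digroups by blast
  \<comment> \<open>Absorbing \<open>l' \<turnstile> l\<close> and \<open>r \<turnstile> r'\<close>
    at once equals absorbing \<open>l\<close>, \<open>r\<close> first and \<open>l'\<close>,
    \<open>r'\<close> afterwards.\<close>
  have "((l' \<turnstile>\<^bsub>D i\<^esub> l) \<turnstile>\<^bsub>D i\<^esub> a) \<stileturn>\<^bsub>D i\<^esub> (r \<turnstile>\<^bsub>D i\<^esub> r') = (l' \<turnstile>\<^bsub>D i\<^esub> c) \<stileturn>\<^bsub>D i\<^esub> r'"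
    using * i by (simp add: c_def Di.ldot_assoc Di.rdot_assoc Di.inner_assoc Di.rdot_ldot Di.ldot_closed Di.rdot_closed)
  moreover have "cw (u @ [l]) a (r # v) = (p, ((l' \<turnstile>\<^bsub>D i\<^esub> l) \<turnstile>\<^bsub>D i\<^esub> a) \<stileturn>\<^bsub>D i\<^esub> (r \<turnstile>\<^bsub>D i\<^esub> r'), q)"
    using ul rv * i J assms False bracket_post_pre[of i a p "l' \<turnstile>\<^bsub>D i\<^esub> l" q "r \<turnstile>\<^bsub>D i\<^esub> r'"]
    by (simp add: cw_def reduce_eq group_part_ldot_closed)
  ultimately show ?thesis
    using * by (simp flip: c_def)
qed

text \<open>Bracketing before extending by \<open>w\<close> and \<open>w'\<close> is harmless:
  \<open>cw_post_pre\<close> releases \<open>l\<close> and \<open>r\<close> from the center again,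
  which restores the normal forms of \<open>u\<close> and \<open>v\<close>. For a center in
  \<open>J\<close> the invariance of the whole word, \<open>cw_sharp\<close>, suffices.\<close>

lemma cw_absorb:
  assumes "u \<in> lists J" "v \<in> lists J" "a \<in> L" "cw u a v = (p, c, q)"
    and "w \<in> lists J" "w' \<in> lists J"
  shows "cw (w @ p) c (q @ w') = cw (w @ u) a (v @ w')"
proof (cases "a \<in> J")
  case True
  obtain c' q' where c: "c' \<in> J" "q' \<in> core" "cw u a v = ([], c', q')"
    using cw_group[OF assms(1,2) True] by blast
  then have c: "c \<in> J" "p = []" "q \<in> lists J"
    using assms by (auto simp: core_lists)
  have "nf (w @ (p @ [S c] @ q) @ w') = nf (w @ (u @ [S a] @ v) @ w')"
    using cw_sharp[OF assms(1-4)] assms c True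
    by (intro nf_append_cong[of w w] nf_append_cong[of _ _ w' w']) (auto simp: sharp_id)
  then show ?thesis
    using c True assms by (simp add: cw_def sharp_id reduce_eq)
next
  case False
  have i: "idx a \<in> I" "a \<in> carrier (D (idx a))"
    using assms idx_mem by auto
  obtain p' l r q' where *: "p' \<in> core" "avoids (idx a) (rev p')" "l \<in> group_part (D (idx a))" "nf u = post p' l"
    "q' \<in> core" "avoids (idx a) q'" "r \<in> group_part (D (idx a))" "nf v = pre r q'"
    "cw u a v = (p', (l \<turnstile>\<^bsub>D (idx a)\<^esub> a) \<stileturn>\<^bsub>D (idx a)\<^esub> r, q')"
    using cw_decompose[OF assms(1,2) i False] .
  then have eq: "p = p'" "c = (l \<turnstile>\<^bsub>D (idx a)\<^esub> a) \<stileturn>\<^bsub>D (idx a)\<^esub> r" "q = q'"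
    using assms by auto
  have J: "l \<in> J" "r \<in> J" "p \<in> lists J" "q \<in> lists J"
    using i * eq group_part_letter core_lists by auto
  have "cw (w @ p) c (q @ w') = cw (w @ p @ [l]) a (r # q @ w')"
    unfolding eq using cw_post_pre[OF i *(3,7), of "w @ p'" "q' @ w'"] J assms eq by simp
  also have "\<dots> = cw (w @ u) a (v @ w')"
  proof (intro cw_cong)
    have "nf (p @ [l]) = nf u"
      using * eq nf_post[of p l] nf_nf assms by metis
    then show "nf (w @ p @ [l]) = nf (w @ u)"
      using J assms by (intro nf_append_cong) auto
    have "nf (r # q) = nf v"
      using * eq nf_pre[of r q] nf_nf assms by metis
    then have "nf ((r # q) @ w') = nf (v @ w')"
      using J assms by (intro nf_append_cong) auto
    then show "nf (r # q @ w') = nf (v @ w')"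
      by simp
  qed (use J assms in auto)
  finally show ?thesis .
qed

end


section \<open>The digroup of center-words\<close>

context digroup_family
begin

abbreviation CW where "CW \<equiv> cw_digroup I D e"

lemma CW_simps [simp]:
  "carrier CW = center_words I D e"
  "x \<turnstile>\<^bsub>CW\<^esub> y = cw_ldot I D e x y"
  "x \<stileturn>\<^bsub>CW\<^esub> y = cw_rdot I D e x y"
  "bar_unit CW = ([], e, [])"
  by (simp_all add: cw_digroup_def center_letter_def)

text \<open>Sharp fixes words over \<open>J\<close>, except that the empty word becomes
  \<open>[e]\<close>; this extra letter disappears because \<open>e\<close> acts trivially on normal
  forms.\<close>

lemma cw_ldot_center_words:
  assumes x: "(u, a, v) \<in> center_words I D e" and y: "(u', a', v') \<in> center_words I D e"
  shows "cw_ldot I D e (u, a, v) (u', a', v') = cw (u @ [S a] @ v @ u') a' v'"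
proof -
  note lists = center_wordsD[OF x] center_wordsD[OF y]
  have S: "S a \<in> J"
    using lists sharp_group_letter by blast
  have nf: "foldr act (rword w) z = foldr act w z" for w z
    by (simp add: rword_def)
  show ?thesis
    using lists S
    by (auto simp: cw_ldot_def cw_def sharp_word_id sharp_id Let_def rword_lists
        reduce_eq nf_append nf nf_def rword_def[of "[_]"] sharp_word_def[of _ _ _ "[_]"]
        nf_of_core[unfolded nf_def] intro!: arg_cong[of _ _ group_bracket])
qed

lemma cw_rdot_center_words:
  assumes x: "(u, a, v) \<in> center_words I D e" and y: "(u', a', v') \<in> center_words I D e"
  shows "cw_rdot I D e (u, a, v) (u', a', v') = cw u a (v @ u' @ [S a'] @ v')"
proof -
  note lists = center_wordsD[OF x] center_wordsD[OF y]
  have S: "S a' \<in> J"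
    using lists sharp_group_letter by blast
  have nf: "foldr act (rword w) z = foldr act w z" for w z
    by (simp add: rword_def)
  show ?thesis
    using lists S
    by (auto simp: cw_rdot_def cw_def sharp_word_id sharp_id Let_def rword_lists
        reduce_eq nf_append nf nf_def rword_def[of "[_]"] sharp_word_def[of _ _ _ "[_]"]
        nf_of_core[unfolded nf_def] intro!: arg_cong[of _ _ group_bracket])
qed

text \<open>\<open>cw_sharp\<close> undoes the bracketing of the left argument and
  \<open>cw_absorb\<close>, with empty context on the right, that of the right argument.\<close>

lemma cw_ldot_cw:
  assumes "u \<in> lists J" "v \<in> lists J" "a \<in> L" "u' \<in> lists J" "v' \<in> lists J" "a' \<in> L"
  shows "cw_ldot I D e (cw u a v) (cw u' a' v') = cw (u @ [S a] @ v @ u') a' v'"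
proof -
  obtain p c q where x: "cw u a v = (p, c, q)"
    by (cases "cw u a v")
  obtain p' c' q' where y: "cw u' a' v' = (p', c', q')"
    by (cases "cw u' a' v'")
  have xy: "(p, c, q) \<in> center_words I D e" "(p', c', q') \<in> center_words I D e"
    using cw_center_words assms x y by metis+
  note lists = center_wordsD[OF xy(1)] center_wordsD[OF xy(2)]
  have S: "S a \<in> J" "S c \<in> J"
    using assms lists sharp_group_letter by blast+
  have "nf ((p @ [S c] @ q) @ u') = nf ((u @ [S a] @ v) @ u')"
    using cw_sharp[OF assms(1-3) x] assms lists S by - (rule nf_append_cong; auto)
  then have "cw ((p @ [S c] @ q) @ u') a' (v' @ []) = cw ((u @ [S a] @ v) @ u') a' (v' @ [])"
    using assms lists S by (intro cw_cong) auto
  with cw_absorb[OF assms(4-6) y, of "p @ [S c] @ q" "[]"] show ?thesis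
    using lists S by (simp add: x y cw_ldot_center_words[OF xy])
qed

lemma cw_rdot_cw:
  assumes "u \<in> lists J" "v \<in> lists J" "a \<in> L" "u' \<in> lists J" "v' \<in> lists J" "a' \<in> L"
  shows "cw_rdot I D e (cw u a v) (cw u' a' v') = cw u a (v @ u' @ [S a'] @ v')"
proof -
  obtain p c q where x: "cw u a v = (p, c, q)"
    by (cases "cw u a v")
  obtain p' c' q' where y: "cw u' a' v' = (p', c', q')"
    by (cases "cw u' a' v'")
  have xy: "(p, c, q) \<in> center_words I D e" "(p', c', q') \<in> center_words I D e"
    using cw_center_words assms x y by metis+
  note lists = center_wordsD[OF xy(1)] center_wordsD[OF xy(2)]
  have S: "S a' \<in> J" "S c' \<in> J"
    using assms lists sharp_group_letter by blast+
  have "nf (v @ (p' @ [S c'] @ q')) = nf (v @ (u' @ [S a'] @ v'))"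
    using cw_sharp[OF assms(4-6) y] assms lists S by - (rule nf_append_cong; auto)
  then have "cw ([] @ u) a (v @ (p' @ [S c'] @ q')) = cw ([] @ u) a (v @ (u' @ [S a'] @ v'))"
    using assms lists S by (intro cw_cong) auto
  with cw_absorb[OF assms(1-3) x, of "[]" "p' @ [S c'] @ q'"] show ?thesis
    using lists S by (simp add: x y cw_rdot_center_words[OF xy])
qed

lemma sharp_unit: "S e = e"
  by (simp add: sharp_id)

lemma unit_center_word: "([], e, []) \<in> center_words I D e"
  using core_Nil by (auto simp: center_words_iff rword_def)

lemma cw_unit:
  assumes "u \<in> lists J" "v \<in> lists J"
  shows "cw u e v = group_bracket (reduce I D e (u @ v))"
proof -
  have "nf (u @ [e] @ v) = nf (u @ v)"
    by (simp add: nf_def)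
  then show ?thesis
    using assms by (simp add: cw_def reduce_eq)
qed

lemma unit_eq_cw: "([], e, []) = cw [] e []"
  using cw_of_center_word[OF unit_center_word] by simp

lemma nf_unit_append: "nf (e # v) = nf v" "nf (u @ e # v) = nf (u @ v)"
  by (simp_all add: nf_def)

text \<open>The inverse is built in reversed order, each letter being inverted in its own group
  part; both products cancel from the inside out.\<close>

lemma ex_word_inverse: "w \<in> lists J \<Longrightarrow> \<exists>w'\<in>lists J. nf (w @ w') = [] \<and> nf (w' @ w) = []"
proof (induction w)
  case (Cons a w)
  then obtain w' where w: "w \<in> lists J" "w' \<in> lists J" "nf (w @ w') = []" "nf (w' @ w) = []"
    by auto
  have i: "idx a \<in> I" "a \<in> group_part (D (idx a))" "a \<in> J"
    using Cons idx_group_part idx_mem group_letters_subset by auto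
  then obtain b where b: "b \<in> group_part (D (idx a))" "a \<turnstile>\<^bsub>D (idx a)\<^esub> b = e" "b \<turnstile>\<^bsub>D (idx a)\<^esub> a = e"
    using digroup.group_part_inverse digroups common_unit by metis
  have "b \<in> J"
    using b i group_part_letter by auto
  have "nf ((w @ w') @ [b]) = nf ([] @ [b])"
    using w \<open>b \<in> J\<close> by - (rule nf_append_cong; auto)
  then have "nf ([a] @ (w @ w') @ [b]) = nf ([a] @ [b])"
    using w \<open>b \<in> J\<close> i by - (rule nf_append_cong; auto)
  also have "\<dots> = []"
    using group_part_nf2[of "idx a" a b "[]" "[]"] i b by simp
  finally have "nf ((a # w) @ w' @ [b]) = []"
    by simp
  moreover have "nf ((w' @ [b]) @ a # w) = []"
    using group_part_nf2[of "idx a" b a w w'] i b w by (simp add: nf_unit_append)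
  ultimately show ?case
    using w \<open>b \<in> J\<close> by (intro bexI[of _ "w' @ [b]"]) auto
qed (auto intro: bexI[of _ "[]"])

lemma digroup_CW: "digroup CW"
proof
  fix x y
  assume xy: "x \<in> carrier CW" "y \<in> carrier CW"
  then obtain u a v where x: "u \<in> lists J" "a \<in> L" "v \<in> lists J" "x = cw u a v"
    using center_word_cases by (metis CW_simps(1))
  obtain u' a' v' where y: "u' \<in> lists J" "a' \<in> L" "v' \<in> lists J" "y = cw u' a' v'"
    using xy center_word_cases by (metis CW_simps(1))
  show "x \<turnstile>\<^bsub>CW\<^esub> y \<in> carrier CW" "x \<stileturn>\<^bsub>CW\<^esub> y \<in> carrier CW"
    using x y by (simp_all add: cw_ldot_cw cw_rdot_cw sharp_group_letter cw_center_words)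
  fix z
  assume "z \<in> carrier CW"
  then obtain u'' a'' v'' where z: "u'' \<in> lists J" "a'' \<in> L" "v'' \<in> lists J" "z = cw u'' a'' v''"
    using center_word_cases by (metis CW_simps(1))
  show "(x \<turnstile>\<^bsub>CW\<^esub> y) \<turnstile>\<^bsub>CW\<^esub> z = x \<turnstile>\<^bsub>CW\<^esub> (y \<turnstile>\<^bsub>CW\<^esub> z)"
    and "(x \<stileturn>\<^bsub>CW\<^esub> y) \<stileturn>\<^bsub>CW\<^esub> z = x \<stileturn>\<^bsub>CW\<^esub> (y \<stileturn>\<^bsub>CW\<^esub> z)"
    and "x \<stileturn>\<^bsub>CW\<^esub> (y \<turnstile>\<^bsub>CW\<^esub> z) = x \<stileturn>\<^bsub>CW\<^esub> (y \<stileturn>\<^bsub>CW\<^esub> z)"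
    and "(x \<stileturn>\<^bsub>CW\<^esub> y) \<turnstile>\<^bsub>CW\<^esub> z = (x \<turnstile>\<^bsub>CW\<^esub> y) \<turnstile>\<^bsub>CW\<^esub> z"
    and "x \<turnstile>\<^bsub>CW\<^esub> (y \<stileturn>\<^bsub>CW\<^esub> z) = (x \<turnstile>\<^bsub>CW\<^esub> y) \<stileturn>\<^bsub>CW\<^esub> z"
    using x y z by (simp_all add: cw_ldot_cw cw_rdot_cw sharp_group_letter)
next
  have unit: "cw_ldot I D e (cw [] e []) x = x \<and> cw_rdot I D e x (cw [] e []) = x"
    if "x \<in> center_words I D e" for x
  proof -
    from that obtain u a v where "u \<in> lists J" "a \<in> L" "v \<in> lists J" "x = cw u a v"
      by (rule center_word_cases)
    moreover have "cw (e # u) a v = cw u a v" "cw u a (v @ [e]) = cw u a v"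
      using \<open>u \<in> lists J\<close> \<open>v \<in> lists J\<close> by (auto intro!: cw_cong simp: nf_unit_append)
    ultimately show ?thesis
      by (simp add: cw_ldot_cw cw_rdot_cw sharp_unit)
  qed
  then show "bar_unit CW \<in> halo_part CW"
    using unit_center_word by (simp add: halo_part_def unit_eq_cw)
next
  fix x
  assume "x \<in> carrier CW"
  then obtain u a v where x: "u \<in> lists J" "a \<in> L" "v \<in> lists J" "x = cw u a v"
    using center_word_cases by (metis CW_simps(1))
  \<comment> \<open>Only \<open>w\<close> enters the products that must be trivial, so the inverse
    can have center \<open>e\<close>: the products become \<open>cw w e w'\<close> and
    \<open>cw [] e (w' @ w)\<close>.\<close>
  define w where "w = u @ [S a] @ v"
  have w: "w \<in> lists J"
    using x sharp_group_letter by (simp add: w_def)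
  then obtain w' where w': "w' \<in> lists J" "nf (w @ w') = []" "nf (w' @ w) = []"
    using ex_word_inverse by blast
  have unit: "cw p e q = cw [] e []" if "p \<in> lists J" "q \<in> lists J" "nf (p @ q) = []" for p q
    using that reduce_cong[of "p @ q" "[]"] by (simp add: cw_unit)
  have "cw_ldot I D e x (cw [] e w') = cw [] e []" "cw_rdot I D e (cw [] e w') x = cw [] e []"
    using unit[of w w'] unit[of "[]" "w' @ w"] x w w'
    by (simp_all add: cw_ldot_cw cw_rdot_cw w_def)
  then show "\<exists>b. is_diinverse CW x b"
    using w' cw_center_words[of "[]" w' e]
    by (intro exI[of _ "cw [] e w'"]) (simp add: is_diinverse_def unit_eq_cw)
qed

section \<open>The group part and the halo part\<close>

lemma group_part_CW: "group_part CW = {group_bracket (rword w) | w. w \<in> core}"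
proof -
  interpret CW: digroup CW
    by (rule digroup_CW)
  show ?thesis
  proof (intro equalityI subsetI)
    fix x
    assume "x \<in> group_part CW"
    then have x: "x \<in> center_words I D e" "cw_ldot I D e x (cw [] e []) = x"
      using CW.group_part_iff by (auto simp: unit_eq_cw)
    then obtain u a v where "u \<in> lists J" "a \<in> L" "v \<in> lists J" "x = cw u a v"
      using center_word_cases by (metis CW_simps(1))
    \<comment> \<open>Right multiplication by the unit makes \<open>e\<close> the center and gathers
      the whole sharp word to its left.\<close>
    moreover from this have "x = cw (u @ [S a] @ v) e []"
      using x(2) by (simp add: cw_ldot_cw)
    ultimately have "x = group_bracket (rword (nf (u @ [S a] @ v)))" "nf (u @ [S a] @ v) \<in> core"
      by (simp_all add: cw_unit sharp_group_letter reduce_eq nf_core)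
    then show "x \<in> {group_bracket (rword w) | w. w \<in> core}"
      by blast
  next
    fix x
    assume "x \<in> {group_bracket (rword w) | w. w \<in> core}"
    then obtain w where w: "w \<in> core" "x = group_bracket (rword w)"
      by auto
    then have x: "x = cw w e []"
      by (simp add: cw_unit core_lists reduce_core)
    then have "cw_ldot I D e x (cw [] e []) = x" "x \<in> center_words I D e"
      using w cw_center_words[of w "[]" e] cw_cong[of "w @ [e]" w "[]" "[]" e]
      by (simp_all add: cw_ldot_cw sharp_unit core_lists nf_unit_append)
    then show "x \<in> group_part CW"
      using CW.group_part_iff by (simp add: unit_eq_cw)
  qed
qed

lemma halo_part_CW:
  "halo_part CW = {(u, a, v). (u, a, v) \<in> center_words I D e \<and>
    reduce I D e (sharp_word I D e u @ sharp_word I D e [a] @ sharp_word I D e v) = [e]}"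
proof -
  have "(u, a, v) \<in> halo_part CW \<longleftrightarrow>
      reduce I D e (sharp_word I D e u @ sharp_word I D e [a] @ sharp_word I D e v) = [e]"
    if x: "(u, a, v) \<in> center_words I D e" for u a v
  proof -
    note lists = center_wordsD[OF x]
    define w where "w = u @ [S a] @ v"
    have w: "w \<in> lists J"
      using lists sharp_group_letter by (simp add: w_def)
    have s: "sharp_word I D e u @ sharp_word I D e [a] @ sharp_word I D e v \<in> lists J"
      using lists sharp_group_letter
      by (simp add: sharp_word_id rword_lists sharp_word_def[of _ _ _ "[_]"])
    have "nf (sharp_word I D e u @ sharp_word I D e [a] @ sharp_word I D e v) = nf w"
      using lists
      by (simp add: sharp_word_id sharp_word_def[of _ _ _ "[_]"] w_def)
        (simp add: rword_def nf_def)
    then have red: "reduce I D e (sharp_word I D e u @ sharp_word I D e [a] @ sharp_word I D e v)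
        = reduce I D e w"
      using s w by (intro reduce_cong)
    have e: "reduce I D e w = [e] \<longleftrightarrow> nf w = []"
      using w nf_core[OF w] by (auto simp: reduce_eq rword_def core_Cons)
    have "(u, a, v) \<in> halo_part CW \<longleftrightarrow> nf w = []"
    proof
      assume "(u, a, v) \<in> halo_part CW"
      then have "cw_ldot I D e (u, a, v) ([], e, []) = ([], e, [])"
        using unit_center_word by (auto simp: halo_part_def)
      then have "group_bracket (reduce I D e w) = ([], e, [])"
        using x w lists unit_center_word
        by (simp add: cw_ldot_center_words cw_unit sharp_group_letter w_def)
      then show "nf w = []"
        using e reduce_ne_Nil[OF w] by (cases "reduce I D e w") (auto simp: group_bracket_def)
    next
      assume nf: "nf w = []"
      have "cw_ldot I D e (u, a, v) y = y \<and> cw_rdot I D e y (u, a, v) = y"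
        if y: "y \<in> center_words I D e" for y
      proof -
        obtain p c q where [simp]: "y = (p, c, q)"
          by (cases y)
        have y: "(p, c, q) \<in> center_words I D e"
          using y by simp
        note lists' = center_wordsD[OF y]
        have "nf (w @ p) = nf ([] @ p)" "nf (q @ w) = nf (q @ [])"
          using w nf lists' by - (rule nf_append_cong; auto)+
        then have "cw (w @ p) c q = cw p c q" "cw p c (q @ w) = cw p c q"
          using w lists' by (auto intro!: cw_cong)
        then show ?thesis
          using x y by (simp add: cw_ldot_center_words cw_rdot_center_words w_def cw_of_center_word)
      qed
      then show "(u, a, v) \<in> halo_part CW"
        using x by (simp add: halo_part_def)
    qed
    then show ?thesis
      by (simp add: red e)
  qed
  then show ?thesis
    by (auto simp: halo_part_def)
qed

section \<open>Isomorphism of the group part with the free product of groups\<close>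

text \<open>A tagged word may carry \<open>e\<close> under any index, but \<open>tag\<close> uses
  only the chosen one. Deleting and reinserting unit letters shows that every class contains a word
  of the form \<open>tag v\<close>, which gives surjectivity of the isomorphism.\<close>

lemma ex_tag_rel:
  assumes "w \<in> FW"
  shows "(w, tag (map snd w)) \<in> FR"
  using assms
proof (induction w)
  case (Cons x w)
  obtain i a where x: "x = (i, a)" "i \<in> I" "a \<in> group_part (D i)"
    using Cons by (cases x) auto
  have w: "w \<in> FW" "(w, tag (map snd w)) \<in> FR"
    using Cons by auto
  have 1: "((i, a) # w, (i, a) # tag (map snd w)) \<in> FR"
    using w x by (intro free_product_rel_Cons)
  show ?case
  proof (cases "a = e")
    case True
    have unit: "((j, e) # tag (map snd w), tag (map snd w)) \<in> FR" if "j \<in> I" for j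
      using free_product_rel.one[of "[]" I "group_parts D" "tag (map snd w)" j] that w
      by (simp add: tag_words free_product_words_lists)
    have "((i, e) # tag (map snd w), (idx e, e) # tag (map snd w)) \<in> FR"
      using unit[OF x(2)] unit[OF idx_mem(1)[OF unit_letter]]
      by (blast intro: free_product_rel.sym free_product_rel.trans)
    then show ?thesis
      using 1 free_product_rel.trans True x by fastforce
  next
    case False
    then have "idx a = i"
      using x idx_eq group_part_carrier by blast
    then show ?thesis
      using 1 x by simp
  qed
qed (simp add: free_product_rel.refl)

lemma free_product_group_iso:
  "group_part_group CW \<cong> free_product_group I (group_parts D)"
proof (rule is_isoI, rule isoI)
  interpret CW: digroup CW
    by (rule digroup_CW)
  \<comment> \<open>In the group part the marked letter is the first one, so \<open>a # v\<close> is
    the full reduced word.\<close>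
  define f :: "'a center_word \<Rightarrow> ('i \<times> 'a) list set" where "f = (\<lambda>(u, a, v). represented I D (a # v))"
  have f: "f (group_bracket w) = represented I D w" if "w \<noteq> []" for w
    using that by (simp add: f_def group_bracket_def)
  have fr: "f (group_bracket (rword w)) = represented I D w" if "w \<in> core" for w
  proof -
    have "f (group_bracket (rword w)) = represented I D (rword w)"
      by (rule f) (simp add: rword_def)
    also have "\<dots> = represented I D w"
      using that by (simp add: represented_eq_iff core_lists rword_lists nf_rword)
    finally show ?thesis .
  qed
  have quot: "represented I D w \<in> FW // FR" if "w \<in> lists J" for w
    using that tag_words by (auto simp: represented_tag free_product_class_def intro!: quotientI)
  have carrier: "carrier (group_part_group CW) = {group_bracket (rword w) | w. w \<in> core}"
    by (simp add: group_part_group_def group_part_CW)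
  show "f \<in> hom (group_part_group CW) (free_product_group I (group_parts D))"
  proof (rule homI)
    fix x
    assume "x \<in> carrier (group_part_group CW)"
    then show "f x \<in> carrier (free_product_group I (group_parts D))"
      using fr quot core_lists by (auto simp: carrier free_product_group_def)
  next
    fix x y
    assume "x \<in> carrier (group_part_group CW)" "y \<in> carrier (group_part_group CW)"
    then obtain v w where vw: "v \<in> core" "w \<in> core"
      "x = group_bracket (rword v)" "y = group_bracket (rword w)"
      by (auto simp: carrier)
    then have J: "v \<in> lists J" "w \<in> lists J"
      by (auto simp: core_lists)
    \<comment> \<open>With center \<open>e\<close> and the words placed on its right, the product is
      \<open>cw (e # v) e w\<close>, which reduces to the concatenation of \<open>v\<close> and
      \<open>w\<close>.\<close>
    have xy: "x = cw [] e v" "y = cw [] e w"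
      using vw J by (simp_all add: cw_unit reduce_core)
    have "x \<otimes>\<^bsub>group_part_group CW\<^esub> y = cw_ldot I D e x y"
      by (simp add: group_part_group_def)
    also have "\<dots> = cw (e # v) e w"
      using xy J by (simp add: cw_ldot_cw sharp_unit)
    also have "\<dots> = group_bracket (reduce I D e (e # v @ w))"
      using J by (simp add: cw_unit)
    also have "f \<dots> = represented I D (v @ w)"
      using J nf_core[of "v @ w"]
      by (simp add: reduce_eq fr nf_unit_append represented_eq_iff core_lists nf_nf)
    also have "\<dots> = f x \<otimes>\<^bsub>free_product_group I (group_parts D)\<^esub> f y"
      using vw J tag_words free_product_class_mult[OF monoid_group_parts, of "tag v" "tag w"]
      by (simp add: fr represented_tag)
    finally show "f (x \<otimes>\<^bsub>group_part_group CW\<^esub> y) = f x \<otimes>\<^bsub>free_product_group I (group_parts D)\<^esub> f y" .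
  qed
  show "bij_betw f (carrier (group_part_group CW)) (carrier (free_product_group I (group_parts D)))"
  proof (intro bij_betw_imageI inj_onI equalityI subsetI)
    fix x y
    assume "x \<in> carrier (group_part_group CW)" "y \<in> carrier (group_part_group CW)" "f x = f y"
    then obtain v w where "v \<in> core" "w \<in> core" "x = group_bracket (rword v)"
      "y = group_bracket (rword w)" "represented I D v = represented I D w"
      by (auto simp: carrier fr)
    then show "x = y"
      by (simp add: represented_eq_iff core_lists nf_of_core)
  next
    fix A
    assume "A \<in> f ` carrier (group_part_group CW)"
    then show "A \<in> carrier (free_product_group I (group_parts D))"
      using fr quot core_lists by (auto simp: carrier free_product_group_def)
  next
    fix A
    assume "A \<in> carrier (free_product_group I (group_parts D))"
    then obtain w where w: "w \<in> FW" "A = FR `` {w}"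
      by (auto simp: free_product_group_def elim!: quotientE)
    have J: "map snd w \<in> lists J"
      using w free_product_words_lists by blast
    have "A = represented I D (map snd w)"
      using equiv_class_eq[OF equiv_free_product_rel[OF monoid_group_parts] ex_tag_rel[OF w(1)]] w
      by (simp add: represented_tag free_product_class_def)
    also have "\<dots> = represented I D (nf (map snd w))"
      using J nf_core[OF J] by (simp only: represented_eq_iff nf_nf core_lists)
    also have "\<dots> = f (group_bracket (rword (nf (map snd w))))"
      using nf_core[OF J] by (simp add: fr)
    finally show "A \<in> f ` carrier (group_part_group CW)"
      using nf_core[OF J] by (auto simp: carrier)
  qed
qed

end


section \<open>The universal property\<close>

locale digroup_family_maps =
  digroup_family I D e + G: digroup G
  for I :: "'i set" and D :: "'i \<Rightarrow> 'a digroup" and e :: 'a and G :: "'b digroup" +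
  fixes \<psi> :: "'i \<Rightarrow> 'a \<Rightarrow> 'b"
  assumes maps: "i \<in> I \<Longrightarrow> \<psi> i \<in> dihom (D i) G"
begin

definition letter_map :: "'a \<Rightarrow> 'b"
  where "letter_map a = \<psi> (idx a) a"

definition word_map :: "'a list \<Rightarrow> 'b"
  where "word_map w = foldr (\<lambda>a x. letter_map a \<turnstile>\<^bsub>G\<^esub> x) w (bar_unit G)"

definition center_word_map :: "'a center_word \<Rightarrow> 'b"
  where "center_word_map = (\<lambda>(u, a, v). (word_map u \<turnstile>\<^bsub>G\<^esub> letter_map a) \<stileturn>\<^bsub>G\<^esub> word_map v)"

lemma map_unit: "i \<in> I \<Longrightarrow> \<psi> i e = bar_unit G"
  using maps common_unit by (auto simp: dihom_def)

lemma letter_map_eq: "\<lbrakk>i \<in> I; a \<in> carrier (D i)\<rbrakk> \<Longrightarrow> letter_map a = \<psi> i a"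
  using idx_eq[of i a] map_unit idx_mem[OF unit_letter] by (cases "a = e") (auto simp: letter_map_def)

lemma letter_map_unit [simp]: "letter_map e = bar_unit G"
  using map_unit idx_mem[OF unit_letter] by (simp add: letter_map_def)

lemma letter_map_closed [simp]: "a \<in> L \<Longrightarrow> letter_map a \<in> carrier G"
  using maps idx_mem by (fastforce simp: letter_map_def dihom_def)

lemma letter_map_group_part [simp]: "a \<in> J \<Longrightarrow> letter_map a \<in> group_part G"
  unfolding letter_map_def
  using dihom_group_part[OF digroups G.digroup_axioms maps]
  by (simp add: idx_mem idx_group_part group_letters_subset)

lemma letter_map_ldot:
  "\<lbrakk>i \<in> I; a \<in> carrier (D i); b \<in> carrier (D i)\<rbrakk>
    \<Longrightarrow> letter_map (a \<turnstile>\<^bsub>D i\<^esub> b) = letter_map a \<turnstile>\<^bsub>G\<^esub> letter_map b"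
  using maps[of i] disemigroup.ldot_closed[OF digroup.axioms(1)[OF digroups]]
  by (simp add: letter_map_eq dihom_def)

lemma letter_map_rdot:
  "\<lbrakk>i \<in> I; a \<in> carrier (D i); b \<in> carrier (D i)\<rbrakk>
    \<Longrightarrow> letter_map (a \<stileturn>\<^bsub>D i\<^esub> b) = letter_map a \<stileturn>\<^bsub>G\<^esub> letter_map b"
  using maps[of i] disemigroup.rdot_closed[OF digroup.axioms(1)[OF digroups]]
  by (simp add: letter_map_eq dihom_def)

lemma letter_map_sharp: "a \<in> L \<Longrightarrow> letter_map (S a) = letter_map a \<turnstile>\<^bsub>G\<^esub> bar_unit G"
  by (simp add: sharp_def letter_map_ldot idx_mem)

lemma word_map_simps [simp]:
  "word_map [] = bar_unit G"
  "word_map (a # w) = letter_map a \<turnstile>\<^bsub>G\<^esub> word_map w"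
  by (simp_all add: word_map_def)

lemma word_map_group_part [simp]: "w \<in> lists J \<Longrightarrow> word_map w \<in> group_part G"
  by (induction w) (auto simp: G.group_part_ldot_closed)

lemma word_map_closed [simp]: "w \<in> lists J \<Longrightarrow> word_map w \<in> carrier G"
  by simp

lemma word_map_append:
  "\<lbrakk>u \<in> lists J; v \<in> lists J\<rbrakk> \<Longrightarrow> word_map (u @ v) = word_map u \<turnstile>\<^bsub>G\<^esub> word_map v"
  by (induction u) (simp_all add: G.ldot_assoc group_letters_subset)

lemma word_map_pre: "w \<in> lists J \<Longrightarrow> word_map (pre b w) = letter_map b \<turnstile>\<^bsub>G\<^esub> word_map w"
  by (simp add: pre_def)

lemma word_map_post:
  "\<lbrakk>w \<in> lists J; b \<in> J\<rbrakk> \<Longrightarrow> word_map (post w b) = word_map w \<turnstile>\<^bsub>G\<^esub> letter_map b"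
  by (simp add: post_def word_map_append)

lemma word_map_rword: "word_map (rword w) = word_map w"
  by (simp add: rword_def)

text \<open>The only multiplication takes place within one \<open>D i\<close>, where the given map
  is a homomorphism. So evaluation in \<open>G\<close> turns the action into left multiplication,
  and a word and its normal form have the same value.\<close>

lemma word_map_act:
  assumes "a \<in> J" "w \<in> core"
  shows "word_map (act a w) = letter_map a \<turnstile>\<^bsub>G\<^esub> word_map w"
proof -
  have i: "idx a \<in> I" "a \<in> group_part (D (idx a))"
    using assms idx_group_part idx_mem group_letters_subset by auto
  obtain b w' where *: "b \<in> group_part (D (idx a))" "w' \<in> core" "avoids (idx a) w'" "w = pre b w'"
    using core_pre_cases[OF i(1) assms(2)] .
  then have "b \<in> J"
    using i group_part_letter by blast
  then show ?thesis
    using i * assms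
    by (simp add: act_pre word_map_pre core_lists letter_map_ldot group_part_carrier G.ldot_assoc
        group_letters_subset)
qed

lemma word_map_nf: "w \<in> lists J \<Longrightarrow> word_map (nf w) = word_map w"
proof (induction w)
  case (Cons a w)
  then show ?case
    using word_map_act[of a "nf w"] nf_core[of w] by (simp add: nf_def)
qed simp

text \<open>The absorbed letters \<open>l\<close> and \<open>r\<close> are multiplied within
  \<open>D (idx a)\<close>, which \<open>letter_map\<close> respects, and the laws of
  \<open>G\<close> move them back to the outer words. For \<open>a\<close> in \<open>J\<close> all
  values lie in the group part of \<open>G\<close>, where the two products agree.\<close>

lemma center_word_map_cw:
  assumes "u \<in> lists J" "v \<in> lists J" "a \<in> L"
  shows "center_word_map (cw u a v) = (word_map u \<turnstile>\<^bsub>G\<^esub> letter_map a) \<stileturn>\<^bsub>G\<^esub> word_map v"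
proof (cases "a \<in> J")
  case True
  obtain c q where c: "rword (nf (u @ [a] @ v)) = c # q" "c \<in> J" "q \<in> core" "cw u a v = ([], c, q)"
    using cw_group[OF assms(1,2) True] by blast
  have "center_word_map (cw u a v) = word_map (c # q)"
    using c by (simp add: center_word_map_def G.group_part_rdot_eq_ldot core_lists group_letters_subset)
  also have "\<dots> = word_map (u @ [a] @ v)"
    using word_map_rword[of "nf (u @ [a] @ v)"] assms True c(1) by (simp add: word_map_nf)
  also have "\<dots> = word_map u \<turnstile>\<^bsub>G\<^esub> (letter_map a \<turnstile>\<^bsub>G\<^esub> word_map v)"
    using assms True by (simp add: word_map_append)
  also have "\<dots> = (word_map u \<turnstile>\<^bsub>G\<^esub> letter_map a) \<stileturn>\<^bsub>G\<^esub> word_map v"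
    using assms True by (simp add: G.ldot_rdot_eq_ldot_ldot)
  finally show ?thesis .
next
  case False
  have i: "idx a \<in> I" "a \<in> carrier (D (idx a))"
    using assms idx_mem by auto
  obtain p l r q where *: "p \<in> core" "avoids (idx a) (rev p)" "l \<in> group_part (D (idx a))" "nf u = post p l"
    "q \<in> core" "avoids (idx a) q" "r \<in> group_part (D (idx a))" "nf v = pre r q"
    "cw u a v = (p, (l \<turnstile>\<^bsub>D (idx a)\<^esub> a) \<stileturn>\<^bsub>D (idx a)\<^esub> r, q)"
    using cw_decompose[OF assms(1,2) i False] .
  have J: "l \<in> J" "r \<in> J" "p \<in> lists J" "q \<in> lists J"
    using i * group_part_letter core_lists by auto
  have la: "l \<turnstile>\<^bsub>D (idx a)\<^esub> a \<in> carrier (D (idx a))"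
    using i * disemigroup.ldot_closed[OF digroup.axioms(1)[OF digroups]] group_part_carrier by blast
  have "word_map u = word_map p \<turnstile>\<^bsub>G\<^esub> letter_map l" "word_map v = letter_map r \<turnstile>\<^bsub>G\<^esub> word_map q"
    using word_map_nf[OF assms(1)] word_map_nf[OF assms(2)] * J by (simp_all add: word_map_pre word_map_post)
  then show ?thesis
    using i * J assms la
    by (simp add: center_word_map_def letter_map_ldot letter_map_rdot group_part_carrier
        G.ldot_assoc G.rdot_assoc G.inner_assoc G.rdot_ldot G.ldot_closed G.rdot_closed group_letters_subset)
qed

lemma center_word_map_hom:
  "restrict center_word_map (carrier CW) \<in> dihom CW G \<inter> extensional (carrier CW)"
proof -
  \<comment> \<open>\<open>rdot_ldot\<close> matches only when \<turnstile> is the outermost product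
    of the right factor; here it sits one level deeper.\<close>
  have mixed: "a \<stileturn>\<^bsub>G\<^esub> (b \<turnstile>\<^bsub>G\<^esub> c \<stileturn>\<^bsub>G\<^esub> d) = a \<stileturn>\<^bsub>G\<^esub> (b \<stileturn>\<^bsub>G\<^esub> (c \<stileturn>\<^bsub>G\<^esub> d))"
    if "a \<in> carrier G" "b \<in> carrier G" "c \<in> carrier G" "d \<in> carrier G" for a b c d
    using that G.rdot_assoc[of a "b \<turnstile>\<^bsub>G\<^esub> c" d]
    by (simp add: G.rdot_assoc G.rdot_ldot G.ldot_closed G.rdot_closed)
  note simps = center_word_map_cw word_map_append sharp_group_letter letter_map_sharp
    group_letters_subset G.ldot_assoc G.rdot_assoc G.inner_assoc G.rdot_ldot G.ldot_rdot
    G.ldot_closed G.rdot_closed cw_center_words cw_ldot_cw cw_rdot_cw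
  have closed: "center_word_map x \<in> carrier G" if "x \<in> center_words I D e" for x
    using that
  proof (rule center_word_cases)
    fix u a v assume "u \<in> lists J" "a \<in> L" "v \<in> lists J" "x = cw u a v"
    then show ?thesis
      by (simp add: simps)
  qed
  have hom: "cw_ldot I D e x y \<in> center_words I D e \<and> cw_rdot I D e x y \<in> center_words I D e \<and>
      center_word_map (cw_ldot I D e x y) = center_word_map x \<turnstile>\<^bsub>G\<^esub> center_word_map y \<and>
      center_word_map (cw_rdot I D e x y) = center_word_map x \<stileturn>\<^bsub>G\<^esub> center_word_map y"
    if x: "x \<in> center_words I D e" and y: "y \<in> center_words I D e" for x y
  proof -
    from x obtain u a v where u: "u \<in> lists J" "a \<in> L" "v \<in> lists J" "x = cw u a v"
      by (rule center_word_cases)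
    from y obtain u' a' v' where u': "u' \<in> lists J" "a' \<in> L" "v' \<in> lists J" "y = cw u' a' v'"
      by (rule center_word_cases)
    show ?thesis
      using u u' by (simp add: simps mixed)
  qed
  have "center_word_map ([], e, []) = bar_unit G"
    by (simp add: center_word_map_def)
  then show ?thesis
    using closed hom unit_center_word by (simp add: dihom_def)
qed

lemma center_word_map_letter: "a \<in> L \<Longrightarrow> center_word_map (center_letter a) = letter_map a"
  by (simp add: center_word_map_def center_letter_def)

text \<open>A center-word is a product of single letters: those of \<open>v\<close> split off on the
  right by \<stileturn>, those of \<open>u\<close> on the left by \<turnstile>. Hence the values on
  letters determine the homomorphism.\<close>

lemma hom_eq_center_word_map:
  assumes hom: "\<eta> \<in> dihom CW G"
    and letter: "\<And>a. a \<in> L \<Longrightarrow> \<eta> (cw [] a []) = letter_map a"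
    and "u \<in> lists J" "v \<in> lists J" "a \<in> L"
  shows "\<eta> (cw u a v) = (word_map u \<turnstile>\<^bsub>G\<^esub> letter_map a) \<stileturn>\<^bsub>G\<^esub> word_map v"
  using assms(3)
proof (induction u rule: list.induct)
  case Nil
  have "\<eta> (cw [] a v) = letter_map a \<stileturn>\<^bsub>G\<^esub> word_map v"
    using assms(4)
  proof (induction v rule: rev_induct)
    case Nil
    then show ?case
      using letter assms(5) by simp
  next
    case (snoc b v)
    have "cw [] a (v @ [b]) = cw_rdot I D e (cw [] a v) (cw [] b [])"
      using snoc.prems assms(5) by (simp add: cw_rdot_cw sharp_id group_letters_subset)
    also have "\<eta> \<dots> = \<eta> (cw [] a v) \<stileturn>\<^bsub>G\<^esub> \<eta> (cw [] b [])"
      using hom snoc.prems assms(5) by (simp add: dihom_def cw_center_words group_letters_subset)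
    finally show ?case
      using snoc letter assms(5)
      by (simp add: word_map_append G.rdot_assoc G.rdot_ldot group_letters_subset)
  qed
  then show ?case
    using assms(5) by simp
next
  case (Cons b u)
  have "cw (b # u) a v = cw_ldot I D e (cw [] b []) (cw u a v)"
    using Cons.prems assms(4,5) by (simp add: cw_ldot_cw sharp_id group_letters_subset)
  also have "\<eta> \<dots> = \<eta> (cw [] b []) \<turnstile>\<^bsub>G\<^esub> \<eta> (cw u a v)"
    using hom Cons.prems assms(4,5) by (simp add: dihom_def cw_center_words group_letters_subset)
  finally show ?case
    using Cons letter assms(4,5)
    by (simp add: G.ldot_assoc G.inner_assoc G.ldot_closed group_letters_subset)
qed

end

section \<open>The embeddings and universality\<close>

context digroup_family
begin

lemma center_letter_cw: "a \<in> L \<Longrightarrow> center_letter a = cw [] a []"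
proof -
  assume "a \<in> L"
  then have "([], a, []) \<in> center_words I D e"
    by (auto simp: center_words_iff avoids_def rword_def core_Cons image_iff
        intro!: bexI[of _ "if a = e then [] else [a]"])
  then show ?thesis
    by (simp add: cw_of_center_word center_letter_def)
qed

text \<open>Each product puts a sharp letter beside a center of the same \<open>D i\<close>, where
  \<open>cw_post_pre\<close> absorbs it. The sharp has no effect there:
  \<open>(a \<turnstile> e) \<turnstile> b = a \<turnstile> b\<close> and
  \<open>a \<stileturn> (b \<turnstile> e) = a \<stileturn> b\<close>.\<close>

lemma center_letter_hom:
  assumes i: "i \<in> I"
  shows "center_letter \<in> dihom (D i) CW"
proof -
  have closed: "a \<turnstile>\<^bsub>D i\<^esub> b \<in> carrier (D i)" "a \<stileturn>\<^bsub>D i\<^esub> b \<in> carrier (D i)"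
    if "a \<in> carrier (D i)" "b \<in> carrier (D i)" for a b
    using that i digroups disemigroup.ldot_closed disemigroup.rdot_closed digroup.axioms(1) by metis+
  have hom: "cw_ldot I D e (cw [] a []) (cw [] b []) = cw [] (a \<turnstile>\<^bsub>D i\<^esub> b) []"
    "cw_rdot I D e (cw [] a []) (cw [] b []) = cw [] (a \<stileturn>\<^bsub>D i\<^esub> b) []"
    if ab: "a \<in> carrier (D i)" "b \<in> carrier (D i)" for a b
  proof -
    interpret Di: digroup "D i"
      using digroups i .
    have S: "S a \<in> group_part (D i)" "S b \<in> group_part (D i)"
      using ab i sharp_group_part by auto
    have cong: "cw [] x [e] = cw [] x []" "cw [e] x [] = cw [] x []" for x
      by (auto intro!: cw_cong)
    have l: "S a \<turnstile>\<^bsub>D i\<^esub> b = a \<turnstile>\<^bsub>D i\<^esub> b"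
      using ab i by (simp add: sharp_eq Di.ldot_assoc)
    have r: "a \<stileturn>\<^bsub>D i\<^esub> S b = a \<stileturn>\<^bsub>D i\<^esub> b"
      using ab i by (simp add: sharp_eq Di.rdot_ldot Di.rdot_assoc[symmetric] closed)
    \<comment> \<open>\<open>cw_post_pre\<close> expects a neighbour on both sides of the center;
      the absent one is filled in with \<open>e\<close>.\<close>
    have "cw ([] @ [S a]) b (e # []) = cw [] ((S a \<turnstile>\<^bsub>D i\<^esub> b) \<stileturn>\<^bsub>D i\<^esub> e) []"
      using i ab S by (intro cw_post_pre) auto
    then have "cw [S a] b [e] = cw [] (a \<turnstile>\<^bsub>D i\<^esub> b) []"
      using i ab closed by (simp add: l)
    moreover have "cw [S a] b [e] = cw [S a] b []"
      using i S group_part_letter by (intro cw_cong) auto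
    ultimately show "cw_ldot I D e (cw [] a []) (cw [] b []) = cw [] (a \<turnstile>\<^bsub>D i\<^esub> b) []"
      using i ab carrier_letter by (simp add: cw_ldot_cw)
    have "cw ([] @ [e]) a (S b # []) = cw [] ((e \<turnstile>\<^bsub>D i\<^esub> a) \<stileturn>\<^bsub>D i\<^esub> S b) []"
      using i ab S by (intro cw_post_pre) auto
    then have "cw [e] a [S b] = cw [] (a \<stileturn>\<^bsub>D i\<^esub> b) []"
      using i ab by (simp add: r)
    moreover have "cw [e] a [S b] = cw [] a [S b]"
      using i S group_part_letter by (intro cw_cong) auto
    ultimately show "cw_rdot I D e (cw [] a []) (cw [] b []) = cw [] (a \<stileturn>\<^bsub>D i\<^esub> b) []"
      using i ab carrier_letter by (simp add: cw_rdot_cw)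
  qed
  show ?thesis
    using i carrier_letter closed hom
    by (auto simp: dihom_def center_letter_cw common_unit unit_eq_cw intro!: cw_center_words)
qed

lemma free_product_CW: "digroup_free_product TYPE('b) I D CW (\<lambda>i. center_letter)"
  unfolding digroup_free_product_def
proof (intro conjI ballI allI impI)
  show "digroup CW"
    by (rule digroup_CW)
  fix i
  assume i: "i \<in> I"
  then show "center_letter \<in> dihom (D i) CW"
    by (rule center_letter_hom)
  show "inj_on center_letter (carrier (D i))"
    by (auto simp: inj_on_def center_letter_def)
next
  fix G :: "'b digroup" and \<psi>
  assume G: "digroup G \<and> (\<forall>i\<in>I. \<psi> i \<in> dihom (D i) G)"
  interpret digroup_family_maps I D e G \<psi>
    using G by (auto simp: digroup_family_maps_def digroup_family_maps_axioms_def digroup_family_axioms)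
  show "\<exists>!\<eta>. \<eta> \<in> dihom CW G \<inter> extensional (carrier CW) \<and>
      (\<forall>i\<in>I. \<forall>a\<in>carrier (D i). \<eta> (center_letter a) = \<psi> i a)"
  proof (rule ex1I[of _ "restrict center_word_map (carrier CW)"])
    show "restrict center_word_map (carrier CW) \<in> dihom CW G \<inter> extensional (carrier CW) \<and>
        (\<forall>i\<in>I. \<forall>a\<in>carrier (D i). restrict center_word_map (carrier CW) (center_letter a) = \<psi> i a)"
    proof (intro conjI ballI)
      fix i a
      assume "i \<in> I" "a \<in> carrier (D i)"
      then have "a \<in> L" "letter_map a = \<psi> i a"
        using carrier_letter letter_map_eq by auto
      moreover have "center_letter a \<in> carrier CW"
        using \<open>a \<in> L\<close> by (simp add: center_letter_cw cw_center_words)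
      ultimately show "restrict center_word_map (carrier CW) (center_letter a) = \<psi> i a"
        by (simp add: center_word_map_letter)
    qed (fact center_word_map_hom)
  next
    fix \<eta>
    assume \<eta>: "\<eta> \<in> dihom CW G \<inter> extensional (carrier CW) \<and>
      (\<forall>i\<in>I. \<forall>a\<in>carrier (D i). \<eta> (center_letter a) = \<psi> i a)"
    have letter: "\<eta> (cw [] a []) = letter_map a" if "a \<in> L" for a
      using \<eta> that idx_mem[OF that] by (simp add: letter_map_def flip: center_letter_cw)
    show "\<eta> = restrict center_word_map (carrier CW)"
    proof (rule extensionalityI[of _ "carrier CW"])
      fix x
      assume x: "x \<in> carrier CW"
      then obtain u a v where "u \<in> lists J" "a \<in> L" "v \<in> lists J" "x = cw u a v"
        using center_word_cases by (metis CW_simps(1))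
      then show "\<eta> x = restrict center_word_map (carrier CW) x"
        using x \<eta> letter by (simp add: hom_eq_center_word_map center_word_map_cw)
    qed (use \<eta> in auto)
  qed
qed

end

theorem theorem2p15:
  fixes I :: "'i set" and D :: "'i \<Rightarrow> 'a digroup" and e :: 'a
  assumes nonempty: "I \<noteq> {}"
    and digroups: "\<And>i. i \<in> I \<Longrightarrow> digroup (D i)"
    and common_unit: "\<And>i. i \<in> I \<Longrightarrow> bar_unit (D i) = e"
    and disjoint: "\<And>i t. \<lbrakk>i \<in> I; t \<in> I; i \<noteq> t\<rbrakk> \<Longrightarrow> carrier (D i) \<inter> carrier (D t) = {e}"
  shows "digroup (cw_digroup I D e) \<and>
    digroup_free_product TYPE('b) I D (cw_digroup I D e) (\<lambda>i. center_letter) \<and>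
    (group_part (cw_digroup I D e) =
           {group_bracket (reduce I D e u) | u. u \<in> reduced_words I D e}) \<and>
    group_part_group (cw_digroup I D e) \<cong> free_product_group I (group_parts D) \<and>
    (halo_part (cw_digroup I D e) =
           {(u, a, v). (u, a, v) \<in> center_words I D e \<and>
              reduce I D e (sharp_word I D e u @ sharp_word I D e [a] @ sharp_word I D e v) = [e]})"
proof -
  interpret digroup_family I D e
    by (rule digroup_family.intro) (fact assms)+
  \<comment> \<open>The words in the statement are already reduced, so reducing them again leaves
    the set indexed by \<open>core\<close>.\<close>
  have "reduce I D e (rword w) = rword w" if "w \<in> core" for w
    using that by (simp add: reduce_eq rword_lists core_lists nf_rword nf_of_core)
  then have "{group_bracket (reduce I D e u) | u. u \<in> reduced_words I D e} =
      {group_bracket (rword w) | w. w \<in> core}"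
    by (simp add: Setcompr_eq_image reduced_words_eq image_image)
  then show ?thesis
    using digroup_CW free_product_CW group_part_CW free_product_group_iso halo_part_CW by simp
qed

end
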